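(* Let $n\ge3$, $m\ge1$, and suppose $u=(u_1,\dots,u_m)$ with $u_i(x)=r^{-\frac{2}{p-1}}\psi_i(\theta)$, $r=|x|$, $\theta=x/|x|$, $\psi_i$ smooth on $\mathbb{S}^{n-1}$, is a stable solution of $-\Delta u_i=|u|^{p-1}u_i$ in $\mathbb{R}^n\setminus\{0\}$, $i=1,\dots,m$. If $\frac{n+2}{n-2}<p<p_c(n)$, where $p_c(n)=\infty$ for $n\le10$ and $p_c(n)=\frac{(n-2)^2-4n+8\sqrt{n-1}}{(n-2)(n-10)}$ for $n\ge11$, then each $\psi_i$ is identically zero.
   Context: $|u|=(\sum_iu_i^2)^{1/2}$. Stable means: $\sum_i\int|u|^{p-1}\phi_i^2+(p-1)\sum_{i,j}\int|u|^{p-3}u_iu_j\phi_i\phi_j\le\sum_i\int|\nabla\phi_i|^2$ for all $\phi_i\in C_c^\infty(\mathbb{R}^n\setminus\{0\})$. *)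

theory Defs
  imports "HOL-Analysis.Analysis"
begin

definition partial :: "'n::finite \<Rightarrow> (real^'n \<Rightarrow> real) \<Rightarrow> real^'n \<Rightarrow> real" where
  "partial j f x = frechet_derivative f (at x) (axis j 1)"

fun C_k_on :: "nat \<Rightarrow> (real^'n::finite) set \<Rightarrow> (real^'n \<Rightarrow> real) \<Rightarrow> bool" where
  "C_k_on 0 S f = continuous_on S f"
| "C_k_on (Suc k) S f =
     ((\<forall>x\<in>S. f differentiable (at x)) \<and> (\<forall>j. C_k_on k S (partial j f)))"

definition C_inf_on :: "(real^'n::finite) set \<Rightarrow> (real^'n \<Rightarrow> real) \<Rightarrow> bool" where
  "C_inf_on S f \<longleftrightarrow> open S \<and> (\<forall>k. C_k_on k S f)"

definition laplacian :: "(real^'n::finite \<Rightarrow> real) \<Rightarrow> real^'n \<Rightarrow> real" where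
  "laplacian f x = (\<Sum>j\<in>UNIV. partial j (partial j f) x)"

definition grad_sq :: "(real^'n::finite \<Rightarrow> real) \<Rightarrow> real^'n \<Rightarrow> real" where
  "grad_sq f x = (\<Sum>j\<in>UNIV. (partial j f x)^2)"

definition test_fun :: "(real^'n::finite \<Rightarrow> real) \<Rightarrow> bool" where
  "test_fun \<phi> \<longleftrightarrow> C_inf_on UNIV \<phi> \<and> compact (closure {x. \<phi> x \<noteq> 0})
      \<and> 0 \<notin> closure {x. \<phi> x \<noteq> 0}"

definition stable :: "real \<Rightarrow> (real^'n::finite \<Rightarrow> real^'m::finite) \<Rightarrow> bool" where
  "stable p u \<longleftrightarrow> (\<forall>\<phi> :: 'm \<Rightarrow> real^'n \<Rightarrow> real. (\<forall>i. test_fun (\<phi> i)) \<longrightarrow>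
     (\<Sum>i\<in>UNIV. integral\<^sup>L lborel (\<lambda>x. norm (u x) powr (p - 1) * (\<phi> i x)^2))
     + (p - 1) * (\<Sum>i\<in>UNIV. \<Sum>j\<in>UNIV. integral\<^sup>L lborel
          (\<lambda>x. norm (u x) powr (p - 3) * (u x $ i) * (u x $ j) * \<phi> i x * \<phi> j x))
     \<le> (\<Sum>i\<in>UNIV. integral\<^sup>L lborel (\<lambda>x. grad_sq (\<phi> i) x)))"

definition p_c :: "nat \<Rightarrow> ereal" where
  "p_c n = (if n \<le> 10 then \<infinity> else
     ereal (((real n - 2)^2 - 4 * real n + 8 * sqrt (real n - 1)) / ((real n - 2) * (real n - 10))))"

end

theory Submission
  imports Defs
begin

text \<open>
  Write \<open>\<alpha> = 2 / (p - 1)\<close>. Testing stability with \<open>\<phi>\<^sub>i = u\<^sub>i g\<close> and the equation with \<open>u\<^sub>i g\<^sup>2\<close>,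
  \<open>g\<close> radial, gives \<open>(p - 1) \<integral> |u|\<^sup>p\<^sup>+\<^sup>1 g\<^sup>2 \<le> \<integral> |u|\<^sup>2 |\<nabla>g|\<^sup>2\<close>. On the other hand the equation tested
  with \<open>u\<^sub>i g\<^sup>2\<close>, the Euler relation \<open>x \<bullet> \<nabla>u\<^sub>i = - \<alpha> u\<^sub>i\<close> and \<open>|\<nabla>u\<^sub>i| \<ge> \<alpha> |u\<^sub>i| / r\<close> bound
  \<open>\<integral> |u|\<^sup>p\<^sup>+\<^sup>1 g\<^sup>2\<close> from below by a weighted integral of \<open>|u|\<^sup>2\<close>. With the Hardy-critical choice
  \<open>g = r powr (\<alpha> - (n - 2) / 2) * \<eta> (ln r)\<close> the two bounds combine to
  \<open>\<integral> w (c \<eta>\<^sup>2 - k \<eta> \<eta>' - \<eta>'\<^sup>2) \<le> 0\<close>, where \<open>w = r powr (2 \<alpha> - n) |u|\<^sup>2\<close> is homogeneous of degree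
  \<open>- n\<close> and \<open>c = (p - 1) \<alpha> (n - 2 - \<alpha>) - (\<alpha> - (n - 2) / 2)\<^sup>2\<close> is positive below the
  Joseph-Lundgren exponent. Since \<open>w\<close> is translation invariant in \<open>ln r\<close>, stretching \<open>\<eta>\<close> forces \<open>w = 0\<close>.
  Working with \<open>w\<close> on the whole space avoids integration on the sphere.
\<close>

section \<open>Calculus of \<open>C\<^sup>k\<close> functions\<close>

lemma partial_eqI:
  assumes "(f has_derivative f') (at x)"
  shows "partial j f x = f' (axis j 1)"
  using frechet_derivative_at[OF assms] by (simp add: partial_def)

lemma has_derivative_partial:
  fixes f :: "real^'n::finite \<Rightarrow> real"
  assumes "f differentiable (at x)"
  shows "(f has_derivative (\<lambda>h. \<Sum>j\<in>UNIV. h $ j * partial j f x)) (at x)"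
proof -
  have d: "(f has_derivative frechet_derivative f (at x)) (at x)"
    using assms frechet_derivative_works by blast
  then interpret bounded_linear "frechet_derivative f (at x)"
    by (rule has_derivative_bounded_linear)
  have "frechet_derivative f (at x) h = (\<Sum>j\<in>UNIV. h $ j * partial j f x)" for h
  proof -
    have "frechet_derivative f (at x) h = frechet_derivative f (at x) (\<Sum>j\<in>UNIV. h $ j *\<^sub>R axis j 1)"
      using basis_expansion[of h] by (simp add: scalar_mult_eq_scaleR)
    then show ?thesis by (simp add: sum scaleR partial_def)
  qed
  then show ?thesis using d by presburger
qed

lemma sum_axis_mult [simp]: "(\<Sum>j\<in>UNIV. axis i (1::real) $ j * c j) = c i"
  by (simp add: axis_def if_distrib[where f = "\<lambda>x. x * _"] cong: if_cong)

text \<open>\<open>frechet_derivative\<close> is chosen from the set of all derivatives at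
  \<open>x\<close>. Functions that agree near \<open>x\<close> share this set, so the choices agree
  even where neither is differentiable.\<close>

lemma partial_cong:
  assumes "open S" "x \<in> S" "\<And>y. y \<in> S \<Longrightarrow> f y = g y"
  shows "partial j f x = partial j g x"
proof -
  have "(f has_derivative D) (at x) = (g has_derivative D) (at x)" for D
    using assms has_derivative_transform_within_open[of f D x UNIV S g]
      has_derivative_transform_within_open[of g D x UNIV S f] by auto
  then show ?thesis by (simp add: partial_def frechet_derivative_def)
qed

lemma partial_eq_0:
  assumes "open S" "x \<in> S" "\<And>y. y \<in> S \<Longrightarrow> f y = 0"
  shows "partial j f x = 0"
proof -
  have "partial j f x = partial j (\<lambda>x. 0) x"
    using assms by (intro partial_cong) auto
  also have "\<dots> = 0" by (rule partial_eqI[where f' = "\<lambda>h. 0"]) simp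
  finally show ?thesis .
qed

section \<open>Locality of \<open>C_k_on\<close> and closure under sums, products and
  composition\<close>

lemma C_k_on_cong:
  assumes "open S" "\<And>y. y \<in> S \<Longrightarrow> f y = g y"
  shows "C_k_on k S f \<longleftrightarrow> C_k_on k S g"
  using assms(2)
proof (induction k arbitrary: f g)
  case 0
  then show ?case using continuous_on_cong by simp
next
  case (Suc k)
  have "f differentiable (at x) \<longleftrightarrow> g differentiable (at x)" if "x \<in> S" for x
    using that Suc.prems assms(1) has_derivative_transform_within_open[of f _ x UNIV S g]
      has_derivative_transform_within_open[of g _ x UNIV S f] unfolding differentiable_def by metis
  moreover have "C_k_on k S (partial j f) \<longleftrightarrow> C_k_on k S (partial j g)" for j
    by (intro Suc.IH partial_cong[OF assms(1)] Suc.prems) auto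
  ultimately show ?case by simp
qed

lemma C_k_on_SucD: "C_k_on (Suc k) S f \<Longrightarrow> C_k_on k S f"
proof (induction k arbitrary: f)
  case 0
  then show ?case
    by (auto intro!: continuous_at_imp_continuous_on dest: differentiable_imp_continuous_within)
qed auto

lemma C_k_on_mono: "k \<le> l \<Longrightarrow> C_k_on l S f \<Longrightarrow> C_k_on k S f"
  by (induction rule: dec_induct) (use C_k_on_SucD in blast)+

lemma C_k_on_imp_continuous_on: "C_k_on k S f \<Longrightarrow> continuous_on S f"
  using C_k_on_mono[of 0 k] by simp

lemma C_k_on_Un:
  assumes "open S" "open T" "C_k_on k S f" "C_k_on k T f"
  shows "C_k_on k (S \<union> T) f"
  using assms(3,4) by (induction k arbitrary: f) (auto intro: continuous_on_open_Un assms)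

text \<open>With the derivative exhibited explicitly, only its values along the axes remain to be
  checked. Induction on the order with this rule yields the closure properties below.\<close>

lemma C_k_on_SucI:
  assumes "open S" "\<And>x. x \<in> S \<Longrightarrow> (f has_derivative f' x) (at x)"
    "\<And>j. C_k_on k S (\<lambda>x. f' x (axis j 1))"
  shows "C_k_on (Suc k) S f"
proof -
  have "C_k_on k S (partial j f)" for j
    using C_k_on_cong[OF assms(1), of "partial j f" "\<lambda>x. f' x (axis j 1)"] assms(2,3) partial_eqI
    by blast
  then show ?thesis using assms(2) by (auto simp: differentiable_def)
qed

lemma C_k_on_const: "open S \<Longrightarrow> C_k_on k S (\<lambda>x. c)"
proof (induction k arbitrary: c)
  case (Suc k)
  then show ?case by (intro C_k_on_SucI[where f' = "\<lambda>x h. 0"]) auto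
qed auto

lemma C_k_on_nth:
  assumes "open S"
  shows "C_k_on k S (\<lambda>x. x $ i)"
proof (cases k)
  case 0
  then show ?thesis by (simp add: continuous_on_component)
next
  case (Suc l)
  show ?thesis unfolding Suc
    by (rule C_k_on_SucI[where f' = "\<lambda>x h. h $ i"])
       (simp_all add: assms C_k_on_const bounded_linear_imp_has_derivative[OF bounded_linear_vec_nth])
qed

lemma C_k_on_add:
  assumes "open S" "C_k_on k S f" "C_k_on k S g"
  shows "C_k_on k S (\<lambda>x. f x + g x)"
  using assms(2,3)
proof (induction k arbitrary: f g)
  case (Suc k)
  then show ?case
    by (intro C_k_on_SucI[OF assms(1), where f' = "\<lambda>x h. (\<Sum>j\<in>UNIV. h $ j * partial j f x) + (\<Sum>j\<in>UNIV. h $ j * partial j g x)"])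
       (auto intro!: has_derivative_add has_derivative_partial)
qed (auto intro: continuous_on_add continuous_on_mult)

lemma C_k_on_sum:
  assumes "open S" "\<And>i. i \<in> I \<Longrightarrow> C_k_on k S (f i)"
  shows "C_k_on k S (\<lambda>x. \<Sum>i\<in>I. f i x)"
  using assms(2)
  by (induction I rule: infinite_finite_induct) (auto intro!: C_k_on_const C_k_on_add assms(1))

lemma C_k_on_mult:
  assumes "open S" "C_k_on k S f" "C_k_on k S g"
  shows "C_k_on k S (\<lambda>x. f x * g x)"
  using assms(2,3)
proof (induction k arbitrary: f g)
  case (Suc k)
  from Suc.prems have "C_k_on k S f" "C_k_on k S g" by (blast dest: C_k_on_SucD)+
  with Suc show ?case
    by (intro C_k_on_SucI[OF assms(1), where f' = "\<lambda>x h. f x * (\<Sum>j\<in>UNIV. h $ j * partial j g x) + (\<Sum>j\<in>UNIV. h $ j * partial j f x) * g x"])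
       (auto intro!: has_derivative_mult has_derivative_partial C_k_on_add assms(1))
qed (auto intro: continuous_on_add continuous_on_mult)

lemma C_k_on_compose:
  fixes \<Phi> :: "real^'n::finite \<Rightarrow> real^'m::finite"
  assumes "open S" "C_k_on k U f" "\<And>x. x \<in> S \<Longrightarrow> \<Phi> x \<in> U" "\<And>i. C_k_on k S (\<lambda>x. \<Phi> x $ i)"
  shows "C_k_on k S (\<lambda>x. f (\<Phi> x))"
  using assms(2,4)
proof (induction k arbitrary: f)
  case 0
  have "continuous_on S \<Phi>" using 0(2) continuous_on_vec_lambda[of S "\<lambda>i x. \<Phi> x $ i"] by simp
  then show ?case using 0 assms(3) by (auto intro!: continuous_on_compose2[of U f S \<Phi>])
next
  case (Suc k)
  let ?D = "\<lambda>x h. \<chi> i. \<Sum>j\<in>UNIV. h $ j * partial j (\<lambda>x. \<Phi> x $ i) x"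
  have D: "(\<Phi> has_derivative ?D x) (at x)" if "x \<in> S" for x
    using Suc.prems(2) that
    by (subst has_derivative_componentwise_within)
       (auto simp: Basis_vec_def inner_axis intro!: has_derivative_partial)
  have "C_k_on k S (\<lambda>x. \<Phi> x $ i)" for i using Suc.prems(2) C_k_on_SucD by blast
  then have "C_k_on k S (\<lambda>x. partial i f (\<Phi> x))" for i using Suc by auto
  moreover have "((\<lambda>x. f (\<Phi> x)) has_derivative (\<lambda>h. \<Sum>i\<in>UNIV. ?D x h $ i * partial i f (\<Phi> x))) (at x)"
    if "x \<in> S" for x
    using Suc.prems(1) assms(3)[OF that] by (intro has_derivative_compose[OF D[OF that] has_derivative_partial]) auto
  ultimately show ?case using Suc.prems
    by (intro C_k_on_SucI[OF assms(1), where f' = "\<lambda>x h. \<Sum>i\<in>UNIV. ?D x h $ i * partial i f (\<Phi> x)"])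
       (auto intro!: C_k_on_sum C_k_on_mult assms(1,3)
        )
qed

text \<open>\<open>D m\<close> stands for the m-th derivative of the outer function. The induction
  lets \<open>m\<close> vary, because the chain rule brings in \<open>D (Suc m)\<close>.\<close>

lemma C_k_on_compose_real:
  assumes "open S" "C_k_on k S f" "\<And>x. x \<in> S \<Longrightarrow> f x \<in> T"
    and D: "\<And>m t. t \<in> T \<Longrightarrow> (D m has_real_derivative D (Suc m) t) (at t)"
  shows "C_k_on k S (\<lambda>x. D m (f x))"
  using assms(2)
proof (induction k arbitrary: m)
  case 0
  have "continuous_on T (D m)"
    using D by (intro continuous_at_imp_continuous_on) (auto intro: DERIV_isCont)
  then show ?case using 0 assms(3) by (auto intro!: continuous_on_compose2[of T "D m" S f])
next
  case (Suc k)
  have "((\<lambda>x. D m (f x)) has_derivative (\<lambda>h. D (Suc m) (f x) * (\<Sum>j\<in>UNIV. h $ j * partial j f x))) (at x)"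
    if "x \<in> S" for x
    using Suc.prems that D[OF assms(3)[OF that], of m] unfolding has_field_derivative_def
    by (auto intro!: has_derivative_compose[OF has_derivative_partial])
  moreover have "C_k_on k S (\<lambda>x. D (Suc m) (f x))" using Suc C_k_on_SucD by blast
  ultimately show ?case using Suc.prems
    by (intro C_k_on_SucI[OF assms(1), where f' = "\<lambda>x h. D (Suc m) (f x) * (\<Sum>j\<in>UNIV. h $ j * partial j f x)"])
       (auto intro!: C_k_on_mult assms(1))
qed

section \<open>Real powers and logarithms of positive functions and of the norm\<close>

lemma C_k_on_powr:
  assumes "open S" "C_k_on k S f" "\<And>x. x \<in> S \<Longrightarrow> f x > 0"
  shows "C_k_on k S (\<lambda>x. f x powr a)"
proof -
  \<comment> \<open>\<open>?D m\<close> is the m-th derivative of \<open>t powr a\<close>; the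
    product is the falling factorial of \<open>a\<close>.\<close>
  let ?D = "\<lambda>m t. (\<Prod>l<m. a - real l) * t powr (a - real m)"
  have "(?D m has_real_derivative ?D (Suc m) t) (at t)" if "t \<in> {0<..}" for m t
    using that by (auto intro!: derivative_eq_intros simp: algebra_simps)
  from C_k_on_compose_real[where D = ?D and m = 0 and T = "{0<..}", OF assms(1,2) _ this] assms(3)
  show ?thesis by simp
qed

lemma C_k_on_inverse:
  assumes "open S" "C_k_on k S f" "\<And>x. x \<in> S \<Longrightarrow> f x > 0"
  shows "C_k_on k S (\<lambda>x. inverse (f x))"
proof -
  have "f x powr (-1) = inverse (f x)" if "x \<in> S" for x
    using assms(3)[OF that] by (simp add: powr_minus)
  then show ?thesis
    using C_k_on_cong[OF assms(1), of "\<lambda>x. f x powr (-1)" "\<lambda>x. inverse (f x)" k]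
      C_k_on_powr[OF assms, of "-1"] by blast
qed

lemma C_k_on_ln:
  assumes "open S" "C_k_on k S f" "\<And>x. x \<in> S \<Longrightarrow> f x > 0"
  shows "C_k_on k S (\<lambda>x. ln (f x))"
proof (cases k)
  case 0
  have "x \<in> S \<Longrightarrow> f x \<noteq> 0" for x using assms(3)[of x] by simp
  then show ?thesis using assms(2) 0 by (auto intro!: continuous_on_ln)
next
  case (Suc l)
  have D: "((\<lambda>x. ln (f x)) has_derivative (\<lambda>h. inverse (f x) * (\<Sum>j\<in>UNIV. h $ j * partial j f x))) (at x)"
    if "x \<in> S" for x
  proof -
    have "(f has_derivative (\<lambda>h. \<Sum>j\<in>UNIV. h $ j * partial j f x)) (at x)"
      using assms(2) that Suc by (intro has_derivative_partial) auto
    from has_derivative_ln[OF assms(3)[OF that] this] show ?thesis by (simp add: mult.commute)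
  qed
  have "C_k_on l S (\<lambda>x. inverse (f x) * partial j f x)" for j
    using assms Suc C_k_on_SucD[of l S f] by (intro C_k_on_mult C_k_on_inverse) auto
  then show ?thesis unfolding Suc
    by (intro C_k_on_SucI[OF assms(1) D]) simp_all
qed

text \<open>Off the origin the sum of squares is a positive polynomial, and the norm to the power
  \<open>a\<close> is its power \<open>a/2\<close>.\<close>

lemma C_k_on_norm_powr: "C_k_on k (- {0}) (\<lambda>x::real^'n::finite. norm x powr a)"
proof -
  have "0 < (\<Sum>i\<in>UNIV. x $ i * x $ i)" if "x \<noteq> 0" for x :: "real^'n"
    using that inner_gt_zero_iff[of x] by (simp add: inner_vec_def del: inner_gt_zero_iff)
  then have "C_k_on k (- {0}) (\<lambda>x::real^'n. (\<Sum>i\<in>UNIV. x $ i * x $ i) powr (a/2))"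
    by (intro C_k_on_powr C_k_on_sum C_k_on_mult C_k_on_nth) auto
  moreover have "(\<lambda>x::real^'n. (\<Sum>i\<in>UNIV. x $ i * x $ i) powr (a/2)) = (\<lambda>x. norm x powr a)"
  proof
    fix x :: "real^'n"
    have "(\<Sum>i\<in>UNIV. x $ i * x $ i) = norm x powr 2"
      by (simp add: power2_norm_eq_inner inner_vec_def)
    then show "(\<Sum>i\<in>UNIV. x $ i * x $ i) powr (a/2) = norm x powr a" by (simp only: powr_powr) simp
  qed
  ultimately show ?thesis by (simp only:)
qed

lemma C_k_on_ln_norm: "C_k_on k (- {0}) (\<lambda>x. ln (norm x))"
proof -
  have "C_k_on k (- {0}) (\<lambda>x. ln (norm x powr 1))"
    by (intro C_k_on_ln C_k_on_norm_powr) auto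
  then show ?thesis by simp
qed

lemma partial_mult:
  fixes f g :: "real^'n::finite \<Rightarrow> real"
  assumes "f differentiable (at x)" "g differentiable (at x)"
  shows "partial j (\<lambda>x. f x * g x) x = f x * partial j g x + partial j f x * g x"
  using has_derivative_mult[OF has_derivative_partial[OF assms(1)] has_derivative_partial[OF assms(2)]]
  by (rule partial_eqI[THEN trans]) simp

lemma C_k_on_partial: "C_k_on (Suc k) S f \<Longrightarrow> C_k_on k S (partial j f)"
  by simp

lemma C_k_on_differentiable: "C_k_on (Suc k) S f \<Longrightarrow> x \<in> S \<Longrightarrow> f differentiable (at x)"
  by simp

text \<open>The punctured space and the unit ball are open and cover everything; on the ball the
  function is zero. This is how products with a cut-off absorb the singularity at the
  origin.\<close>

lemma C_k_on_UNIV_if_zero: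
  fixes f :: "real^'a::finite \<Rightarrow> real"
  assumes "C_k_on k (- {0}) f" "\<And>x. norm x < 1 \<Longrightarrow> f x = 0"
  shows "C_k_on k UNIV f"
proof -
  have "C_k_on k (ball 0 1) f"
    using C_k_on_cong[of "ball 0 1" f "\<lambda>x. 0"] assms(2) C_k_on_const[of "ball 0 1"] by simp
  then have "C_k_on k (- {0} \<union> ball 0 1) f" using assms by (intro C_k_on_Un) auto
  moreover have "- {0} \<union> ball 0 1 = (UNIV :: (real^'a) set)" by auto
  ultimately show ?thesis by simp
qed

section \<open>A smooth bump function\<close>

text \<open>\<open>flat k\<close> is the \<open>k\<close>-th derivative of the function \<open>exp (- 1 / t)\<close>, extended by zero to \<open>t \<le> 0\<close>.\<close>

primrec flat_poly :: "nat \<Rightarrow> real poly" where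
  "flat_poly 0 = 1"
| "flat_poly (Suc k) = [:0, 0, 1:] * (flat_poly k - pderiv (flat_poly k))"

definition flat :: "nat \<Rightarrow> real \<Rightarrow> real" where
  "flat k t = (if t \<le> 0 then 0 else poly (flat_poly k) (1 / t) * exp (- (1 / t)))"

lemma poly_mult_exp_minus_tendsto_0: "((\<lambda>s. poly q s * exp (- s)) \<longlongrightarrow> (0::real)) at_top"
proof -
  have "((\<lambda>s. \<Sum>i\<le>degree q. coeff q i * (s ^ i / exp s)) \<longlongrightarrow> (\<Sum>i\<le>degree q. coeff q i * 0)) at_top"
    by (intro tendsto_sum tendsto_mult tendsto_const tendsto_power_div_exp_0)
  then show ?thesis by (simp add: poly_altdef sum_distrib_right exp_minus divide_inverse mult.assoc)
qed

lemma poly_inverse_mult_exp_tendsto_0: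
  "((\<lambda>t. poly q (1 / t) * exp (- (1 / t))) \<longlongrightarrow> (0::real)) (at_right 0)"
  using filterlim_compose[OF poly_mult_exp_minus_tendsto_0 filterlim_inverse_at_top_right]
  by (simp add: inverse_eq_divide)

text \<open>For \<open>t > 0\<close> put \<open>s = 1 / t\<close>: differentiating
  \<open>q(s) exp(-s)\<close> in \<open>t\<close> gives \<open>s^2 (q - q')(s) exp(-s)\<close>, the
  recursion of \<open>flat_poly\<close>. At 0 both one-sided difference quotients tend to 0, as
  exponential decay beats polynomial growth.\<close>

lemma flat_has_derivative: "(flat k has_real_derivative flat (Suc k) t) (at t)"
proof -
  consider "t < 0" | "t = 0" | "t > 0" by linarith
  then show ?thesis
  proof cases
    case 1
    have "((\<lambda>t. 0) has_real_derivative flat (Suc k) t) (at t)" using 1 by (simp add: flat_def)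
    then show ?thesis
      by (rule has_field_derivative_transform_within_open[where S = "{..<0}"]) (use 1 in \<open>auto simp: flat_def\<close>)
  next
    case 2
    have "((\<lambda>y. flat k y / y) \<longlongrightarrow> 0) (at_right 0)"
    \<comment> \<open>\<open>pCons 0\<close> multiplies the polynomial by its variable
      \<open>1 / y\<close>, which accounts for the division by \<open>y\<close>.\<close>
    proof (rule Lim_transform_eventually[OF poly_inverse_mult_exp_tendsto_0[of "pCons 0 (flat_poly k)"]])
      show "\<forall>\<^sub>F y in at_right 0. poly (pCons 0 (flat_poly k)) (1 / y) * exp (- (1 / y)) = flat k y / y"
        by (auto simp: eventually_at_filter flat_def)
    qed
    moreover have "((\<lambda>y. flat k y / y) \<longlongrightarrow> 0) (at_left 0)"
    proof (rule Lim_transform_eventually[OF tendsto_const])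
      show "\<forall>\<^sub>F y in at_left 0. 0 = flat k y / y"
        by (auto simp: eventually_at_filter flat_def)
    qed
    ultimately show ?thesis using 2
      by (simp add: has_field_derivative_iff filterlim_split_at flat_def)
  next
    case 3
    have "((\<lambda>t. poly (flat_poly k) (1 / t) * exp (- (1 / t))) has_real_derivative
        poly (pderiv (flat_poly k)) (1 / t) * (- 1 / t\<^sup>2) * exp (- (1 / t))
        + poly (flat_poly k) (1 / t) * (exp (- (1 / t)) * (1 / t\<^sup>2))) (at t)"
      using 3 by (auto intro!: derivative_eq_intros DERIV_chain'[OF _ poly_DERIV, of "\<lambda>t. 1 / t"]
          simp: power2_eq_square)
    also have "poly (pderiv (flat_poly k)) (1 / t) * (- 1 / t\<^sup>2) * exp (- (1 / t))
        + poly (flat_poly k) (1 / t) * (exp (- (1 / t)) * (1 / t\<^sup>2)) = flat (Suc k) t"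
      using 3 by (simp add: flat_def power2_eq_square algebra_simps)
    finally show ?thesis
      by (rule has_field_derivative_transform_within_open[where S = "{0<..}"]) (use 3 in \<open>auto simp: flat_def\<close>)
  qed
qed

lemma C_k_on_flat:
  assumes "open S" "C_k_on k S f"
  shows "C_k_on k S (\<lambda>x. flat m (f x))"
  using C_k_on_compose_real[where D = flat and T = UNIV, OF assms _ flat_has_derivative] by simp

text \<open>A smooth profile, positive exactly on the open interval from 0 to 1; the two factors are
  flat at the two endpoints.\<close>

definition bump :: "real \<Rightarrow> real" where
  "bump s = flat 0 s * flat 0 (1 - s)"

definition bump_deriv :: "real \<Rightarrow> real" where
  "bump_deriv s = flat 1 s * flat 0 (1 - s) - flat 0 s * flat 1 (1 - s)"

lemma bump_has_derivative: "(bump has_real_derivative bump_deriv s) (at s)"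
proof -
  have "((\<lambda>s. flat 0 (1 - s)) has_real_derivative flat 1 (1 - s) * (- 1)) (at s)"
    using flat_has_derivative[of 0 "1 - s"] by (intro DERIV_chain2[of "flat 0"]) (auto intro!: derivative_eq_intros)
  from DERIV_mult[OF flat_has_derivative[of 0 s] this] show ?thesis
    by (simp add: bump_def[abs_def] bump_deriv_def algebra_simps)
qed

lemma bump_outside: "s \<notin> {0<..<1} \<Longrightarrow> bump s = 0" "s \<notin> {0<..<1} \<Longrightarrow> bump_deriv s = 0"
  by (auto simp: bump_def bump_deriv_def flat_def)

lemma continuous_on_flat: "continuous_on S (flat k)"
  using flat_has_derivative by (intro continuous_at_imp_continuous_on) (auto intro: DERIV_isCont)

lemma continuous_on_bump: "continuous_on S bump" and continuous_on_bump_deriv: "continuous_on S bump_deriv"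
  unfolding bump_def[abs_def] bump_deriv_def[abs_def]
  by (intro continuous_intros continuous_on_compose2[OF continuous_on_flat[of UNIV]]; simp)+

lemma bump_pos: "0 < s \<Longrightarrow> s < 1 \<Longrightarrow> bump s > 0"
  by (simp add: bump_def flat_def)

text \<open>The interval is the middle half of the support. In the stretching argument with
  \<open>N = 4 * M\<close> it corresponds to \<open>M \<le> ln (norm x) \<le> 3 * M\<close>.\<close>

lemma bump_lower_bound: "\<exists>d>0. \<forall>s\<in>{1/4..3/4}. bump s \<ge> d"
proof -
  obtain s0 where "s0 \<in> {1/4..3/4}" "\<And>s. s \<in> {1/4..3/4} \<Longrightarrow> bump s0 \<le> bump s"
    using continuous_attains_inf[of "{1/4..3/4}" bump] continuous_on_bump by auto
  moreover from this(1) have "bump s0 > 0" by (intro bump_pos) auto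
  ultimately show ?thesis by blast
qed

lemma bump_upper_bound: "\<exists>K>0. \<forall>s. \<bar>bump s\<bar> \<le> K \<and> \<bar>bump_deriv s\<bar> \<le> K"
proof -
  have "bounded (bump ` {0..1})" "bounded (bump_deriv ` {0..1})"
    by (intro compact_imp_bounded compact_continuous_image continuous_on_bump continuous_on_bump_deriv compact_Icc)+
  then obtain B1 B2 where B: "\<And>s. s \<in> {0..1} \<Longrightarrow> \<bar>bump s\<bar> \<le> B1" "\<And>s. s \<in> {0..1} \<Longrightarrow> \<bar>bump_deriv s\<bar> \<le> B2"
    unfolding bounded_iff real_norm_def by (metis image_eqI)
  have "\<bar>bump s\<bar> \<le> \<bar>B1\<bar> + \<bar>B2\<bar> + 1 \<and> \<bar>bump_deriv s\<bar> \<le> \<bar>B1\<bar> + \<bar>B2\<bar> + 1" for s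
    using B[of s] bump_outside[of s] by (cases "s \<in> {0<..<1}") force+
  then show ?thesis by (intro exI[of _ "\<bar>B1\<bar> + \<bar>B2\<bar> + 1"]) auto
qed

section \<open>Integration over Euclidean space\<close>

lemma continuous_on_UNIV_if_zero:
  fixes f :: "'a::real_normed_vector \<Rightarrow> real"
  assumes "continuous_on (- {0}) f" "\<And>x. norm x < 1 \<Longrightarrow> f x = 0"
  shows "continuous_on UNIV f"
proof -
  have "continuous_on (- {0} \<union> ball 0 1) f"
    using assms continuous_on_cong[of "ball 0 1" "ball 0 1" f "\<lambda>x. 0"]
    by (intro continuous_on_open_Un) auto
  moreover have "- {0} \<union> ball 0 1 = (UNIV :: 'a set)" by auto
  ultimately show ?thesis by simp
qed

lemma integrable_supported_in_cball:
  fixes f :: "'a::euclidean_space \<Rightarrow> real"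
  assumes "continuous_on UNIV f" "\<And>x. norm x > R \<Longrightarrow> f x = 0"
  shows "integrable lborel f"
proof -
  have "integrable lborel (\<lambda>x. indicator (cball 0 R) x *\<^sub>R f x)"
    using assms by (intro borel_integrable_compact) (auto intro: continuous_on_subset)
  also have "(\<lambda>x. indicator (cball 0 R) x *\<^sub>R f x) = f"
    using assms(2) by (auto simp: indicator_def fun_eq_iff)
  finally show ?thesis .
qed

text \<open>Fits integrands that are regular only off the origin: vanishing on the unit ball removes
  the singularity, vanishing far out gives compact support.\<close>

lemma integrable_supported_in_annulus:
  fixes f :: "'a::euclidean_space \<Rightarrow> real"
  assumes "continuous_on (- {0}) f" "\<And>x. norm x < 1 \<Longrightarrow> f x = 0" "\<And>x. norm x > R \<Longrightarrow> f x = 0"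
  shows "integrable lborel f"
  using assms continuous_on_UNIV_if_zero integrable_supported_in_cball by blast

lemma integral_lborel_scaleR:
  fixes f :: "'a::euclidean_space \<Rightarrow> real"
  assumes [measurable]: "f \<in> borel_measurable borel" and "c > 0"
  shows "integral\<^sup>L lborel f = c ^ DIM('a) * integral\<^sup>L lborel (\<lambda>x. f (c *\<^sub>R x))"
proof -
  have "lborel = density (distr lborel borel (\<lambda>x::'a. c *\<^sub>R x)) (\<lambda>_. ennreal (c ^ DIM('a)))"
    using lborel_affine[of c "0::'a"] \<open>c > 0\<close> by (simp add: ennreal_power)
  then have "integral\<^sup>L lborel f = integral\<^sup>L (density (distr lborel borel (\<lambda>x::'a. c *\<^sub>R x)) (\<lambda>_. ennreal (c ^ DIM('a)))) f"
    by simp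
  also have "\<dots> = c ^ DIM('a) * integral\<^sup>L lborel (\<lambda>x. f (c *\<^sub>R x))"
    using \<open>c > 0\<close> by (subst integral_density) (auto simp: integral_distr)
  finally show ?thesis .
qed

text \<open>By translation invariance the difference quotients have integral zero; pass to the limit.\<close>

lemma integral_partial_eq_0:
  fixes f :: "real^'n::finite \<Rightarrow> real"
  assumes f: "C_k_on 1 UNIV f" and zero: "\<And>x. norm x > R \<Longrightarrow> f x = 0"
  shows "integral\<^sup>L lborel (partial j f) = 0"
proof -
  let ?e = "axis j 1 :: real^'n"
  let ?t = "\<lambda>k. inverse (real (Suc k))"
  let ?q = "\<lambda>k x. (f (?t k *\<^sub>R ?e + x) - f x) / ?t k"
  have cont: "continuous_on UNIV f" "continuous_on UNIV (partial j f)"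
    using C_k_on_imp_continuous_on[OF f] f by simp_all
  have diff: "f differentiable (at x)" for x using f by simp
  have pzero: "partial j f x = 0" if "norm x > R" for x
  proof -
    have "open {x::real^'n. norm x > R}" by (intro open_Collect_less continuous_intros)
    then show ?thesis by (rule partial_eq_0) (use that zero in auto)
  qed
  have "bounded (partial j f ` cball 0 R)"
    using cont(2) by (intro compact_imp_bounded compact_continuous_image) (auto intro: continuous_on_subset)
  then obtain B where B0: "\<And>x. x \<in> cball 0 R \<Longrightarrow> \<bar>partial j f x\<bar> \<le> B"
    unfolding bounded_iff real_norm_def by (metis image_eqI)
  then have B: "\<bar>partial j f x\<bar> \<le> \<bar>B\<bar>" for x
    using pzero[of x] B0[of x]
    by (cases "norm x > R") (auto intro: order_trans[OF _ abs_ge_self])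
  have line: "((\<lambda>s. f (s *\<^sub>R ?e + x)) has_real_derivative partial j f (s *\<^sub>R ?e + x)) (at s)" for s x
  proof -
    have "((\<lambda>s. s *\<^sub>R ?e + x) has_derivative (\<lambda>h. h *\<^sub>R ?e)) (at s)"
      by (auto intro!: derivative_eq_intros)
    from has_derivative_compose[OF this has_derivative_partial[OF diff]]
    show ?thesis by (simp add: has_field_derivative_def mult.assoc mult_commute_abs flip: sum_distrib_left)
  qed
  \<comment> \<open>By the mean value theorem along the line in direction \<open>?e\<close>, the
    quotient is a value of the partial derivative.\<close>
  have qbound: "\<bar>?q k x\<bar> \<le> \<bar>B\<bar>" for k x
  proof -
    have "\<exists>z. z > 0 \<and> z < ?t k \<and> f (?t k *\<^sub>R ?e + x) - f (0 *\<^sub>R ?e + x) = (?t k - 0) * partial j f (z *\<^sub>R ?e + x)"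
      by (rule MVT2) (use line in auto)
    then obtain z where "f (?t k *\<^sub>R ?e + x) - f x = ?t k * partial j f (z *\<^sub>R ?e + x)"
      by auto
    then have "?q k x = partial j f (z *\<^sub>R ?e + x)" by (simp add: field_simps)
    then show ?thesis using B by simp
  qed
  have qint: "integral\<^sup>L lborel (?q k) = 0" for k
  proof -
    have i: "integrable lborel f" using cont(1) zero integrable_supported_in_cball by blast
    have "integral\<^sup>L lborel f = integral\<^sup>L (distr lborel borel ((+) (?t k *\<^sub>R ?e))) f"
      by (simp only: lborel_distr_plus)
    also have "\<dots> = integral\<^sup>L lborel (\<lambda>x. f (?t k *\<^sub>R ?e + x))"
      using i by (subst integral_distr) auto
    finally have "integral\<^sup>L lborel (\<lambda>x. f (?t k *\<^sub>R ?e + x)) = integral\<^sup>L lborel f" ..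
    moreover have "integrable lborel (\<lambda>x. f (?t k *\<^sub>R ?e + x))"
      using i integrable_distr_eq[of "(+) (?t k *\<^sub>R ?e)" lborel borel f] by (simp add: lborel_distr_plus)
    ultimately show ?thesis using i by simp
  qed
  \<comment> \<open>The increments are at most 1, so all quotients vanish outside the ball of radius
    \<open>R + 1\<close>, on which the constant \<open>\<bar>B\<bar>\<close> dominates.\<close>
  have "(\<lambda>k. integral\<^sup>L lborel (?q k)) \<longlonglongrightarrow> integral\<^sup>L lborel (partial j f)"
  proof (rule integral_dominated_convergence[where w = "\<lambda>x. indicator (cball 0 (R + 1)) x *\<^sub>R \<bar>B\<bar>"])
    show "partial j f \<in> borel_measurable lborel"
      using cont(2) borel_measurable_continuous_onI by simp
    have "continuous_on UNIV (?q k)" for k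
      by (intro continuous_intros continuous_on_compose2[OF cont(1)]) auto
    then show "?q k \<in> borel_measurable lborel" for k
      using borel_measurable_continuous_onI[of "?q k"] by simp
    show "integrable lborel (\<lambda>x::real^'n. indicator (cball 0 (R + 1)) x *\<^sub>R \<bar>B\<bar>)"
      by (intro borel_integrable_compact) auto
    show "AE x in lborel. (\<lambda>k. ?q k x) \<longlonglongrightarrow> partial j f x"
    proof (intro AE_I2)
      fix x
      have "((\<lambda>h. (f (h *\<^sub>R ?e + x) - f x) / h) \<longlongrightarrow> partial j f x) (at 0)"
        using line[of x 0] by (simp add: DERIV_def)
      then show "(\<lambda>k. ?q k x) \<longlonglongrightarrow> partial j f x"
        by (rule filterlim_compose)
           (use LIMSEQ_inverse_real_of_nat in \<open>auto simp: filterlim_at\<close>)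
    qed
    show "AE x in lborel. norm (?q k x) \<le> indicator (cball 0 (R + 1)) x *\<^sub>R \<bar>B\<bar>" for k
    proof (intro AE_I2)
      fix x
      show "norm (?q k x) \<le> indicator (cball 0 (R + 1)) x *\<^sub>R \<bar>B\<bar>"
      proof (cases "norm x \<le> R + 1")
        case True
        then show ?thesis using qbound by (simp add: indicator_def)
      next
        case False
        have "norm x \<le> norm (?t k *\<^sub>R ?e + x) + norm (?t k *\<^sub>R ?e)"
          using norm_triangle_ineq4[of "?t k *\<^sub>R ?e + x" "?t k *\<^sub>R ?e"] by simp
        moreover have "norm (?t k *\<^sub>R ?e) \<le> 1" by (simp add: divide_simps)
        ultimately have "norm (?t k *\<^sub>R ?e + x) > R" using False by linarith
        then have "f (?t k *\<^sub>R ?e + x) = 0" "f x = 0" using zero False by auto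
        then show ?thesis by simp
      qed
    qed
  qed
  then show ?thesis using qint by (simp add: LIMSEQ_const_iff)
qed

section \<open>Homogeneous weights\<close>

text \<open>The radii are given on a logarithmic scale, so that dilations act as translations of
  \<open>s\<close> and \<open>t\<close>. Half-open shells make adjacent ones disjoint.\<close>

definition annulus_integral :: "('a::euclidean_space \<Rightarrow> real) \<Rightarrow> real \<Rightarrow> real \<Rightarrow> real" where
  "annulus_integral w s t =
     integral\<^sup>L lborel (\<lambda>x. indicator {x. exp s \<le> norm x \<and> norm x < exp t} x *\<^sub>R w x)"

context
  fixes w :: "'a::euclidean_space \<Rightarrow> real"
  assumes cont: "continuous_on (- {0}) w"
    and homogeneous: "\<And>c x. c > 0 \<Longrightarrow> x \<noteq> 0 \<Longrightarrow> c ^ DIM('a) * w (c *\<^sub>R x) = w x"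
begin

lemma annulus_integrand_integrable:
  "integrable lborel (\<lambda>x. indicator {x. exp s \<le> norm x \<and> norm x < exp t} x *\<^sub>R w x)"
proof -
  have "compact (cball 0 (exp t) - ball (0::'a) (exp s))"
    by (intro compact_diff) auto
  moreover have "continuous_on (cball 0 (exp t) - ball 0 (exp s)) w"
    using cont by (rule continuous_on_subset) auto
  ultimately have "set_integrable lborel (cball 0 (exp t) - ball 0 (exp s)) w"
    unfolding set_integrable_def by (rule borel_integrable_compact)
  then have "set_integrable lborel {x. exp s \<le> norm x \<and> norm x < exp t} w"
    by (rule set_integrable_subset) auto
  then show ?thesis by (simp add: set_integrable_def)
qed

text \<open>Scaling by \<open>exp h\<close> moves the shell by \<open>h\<close> in
  \<open>ln (norm x)\<close>. Its Jacobian cancels against the homogeneity of \<open>w\<close>,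
  whose degree is minus the dimension.\<close>

lemma annulus_integral_shift: "annulus_integral w (s + h) (t + h) = annulus_integral w s t"
proof -
  let ?f = "\<lambda>s t x. indicator {x. exp s \<le> norm x \<and> norm x < exp t} x *\<^sub>R w x"
  have meas: "?f (s + h) (t + h) \<in> borel_measurable borel"
    using borel_measurable_integrable[OF annulus_integrand_integrable] by simp
  have "(\<lambda>x. exp h ^ DIM('a) * ?f (s + h) (t + h) (exp h *\<^sub>R x)) = ?f s t"
  proof
    fix x
    show "exp h ^ DIM('a) * ?f (s + h) (t + h) (exp h *\<^sub>R x) = ?f s t x"
      using homogeneous[of "exp h" x]
      by (cases "x = 0") (auto simp: indicator_def exp_add mult.commute[of _ "exp h"] not_le)
  qed
  then show ?thesis
    unfolding annulus_integral_def integral_lborel_scaleR[OF meas exp_gt_zero[of h]]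
    by (simp only: flip: integral_mult_right_zero)
qed

lemma annulus_integral_add:
  assumes "r \<le> s" "s \<le> t"
  shows "annulus_integral w r t = annulus_integral w r s + annulus_integral w s t"
  unfolding annulus_integral_def
proof (subst Bochner_Integration.integral_add[symmetric], goal_cases)
  case 3
  have "exp r \<le> exp s" "exp s \<le> exp t" using assms by auto
  then have "indicator {x. exp r \<le> norm x \<and> norm x < exp t} x *\<^sub>R w x
      = indicator {x. exp r \<le> norm x \<and> norm x < exp s} x *\<^sub>R w x
        + indicator {x. exp s \<le> norm x \<and> norm x < exp t} x *\<^sub>R w x" for x
    using order_trans[of "exp r" "exp s" "norm x"] order_less_le_trans[of "norm x" "exp s" "exp t"]
    by (auto simp: indicator_def not_le not_less simp del: exp_le_cancel_iff)
  then show ?case by simp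
qed (rule annulus_integrand_integrable)+

text \<open>Unit shells tile the large one and carry equal mass by shift invariance.\<close>

lemma annulus_integral_nat: "annulus_integral w 0 (real m) = real m * annulus_integral w 0 1"
proof (induction m)
  case 0
  show ?case by (auto simp: annulus_integral_def indicator_def intro!: integral_eq_zero_AE)
next
  case (Suc m)
  then show ?case
    using annulus_integral_add[of 0 "real m" "real (Suc m)"] annulus_integral_shift[of 0 "real m" 1]
    by (simp add: algebra_simps)
qed

text \<open>Let \<open>C\<close> be the mass of a unit shell. For \<open>N = 4 * M\<close> the term
  with \<open>c\<close> contributes at least a fixed multiple of \<open>M * C\<close>, while the
  terms containing the derivative are of size \<open>1 / N\<close> over logarithmic length
  \<open>N\<close> and stay bounded. Large \<open>M\<close> forces \<open>C = 0\<close>; continuity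
  and homogeneity then give the pointwise claim.\<close>

lemma homogeneous_weight_eq_0:
  assumes nonneg: "\<And>x. w x \<ge> 0" and "c > 0"
    and ineq: "\<And>N. N \<ge> 1 \<Longrightarrow>
      integral\<^sup>L lborel (\<lambda>x. w x * (c * (bump (ln (norm x) / N))\<^sup>2
        - k * bump (ln (norm x) / N) * (bump_deriv (ln (norm x) / N) / N)
        - (bump_deriv (ln (norm x) / N) / N)\<^sup>2)) \<le> 0"
    and "x0 \<noteq> 0"
  shows "w x0 = 0"
proof -
  define C where "C = annulus_integral w 0 1"
  have "C \<ge> 0" unfolding C_def annulus_integral_def
    by (intro integral_nonneg_AE AE_I2) (simp add: nonneg)
  obtain d where d: "d > 0" "\<And>s. s \<in> {1/4..3/4} \<Longrightarrow> bump s \<ge> d" using bump_lower_bound by blast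
  obtain K where K: "K > 0" "\<And>s. \<bar>bump s\<bar> \<le> K" "\<And>s. \<bar>bump_deriv s\<bar> \<le> K" using bump_upper_bound by blast
  have bound: "2 * c * d\<^sup>2 * C * real M \<le> (\<bar>k\<bar> + 1) * K\<^sup>2 * C" if "M \<ge> 1" for M :: nat
  proof -
    \<comment> \<open>This makes the range from \<open>M\<close> to \<open>3 * M\<close> the middle
      half of the stretched support, where the bump is at least \<open>d\<close>.\<close>
    define N where "N = 4 * real M"
    have N: "N \<ge> 1" "real (4 * M) = N" using that by (auto simp: N_def)
    let ?i = "\<lambda>s t x. indicator {x. exp s \<le> norm x \<and> norm x < exp t} x *\<^sub>R w x"
    let ?\<eta> = "\<lambda>x::'a. bump (ln (norm x) / N)" and ?\<eta>' = "\<lambda>x::'a. bump_deriv (ln (norm x) / N) / N"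
    let ?F = "\<lambda>x. w x * (c * (?\<eta> x)\<^sup>2 - k * ?\<eta> x * ?\<eta>' x - (?\<eta>' x)\<^sup>2)"
    \<comment> \<open>Bounds both derivative terms: \<open>\<bar>k\<bar> * K * (K / N)\<close> for
      the mixed one and, since \<open>N \<ge> 1\<close>, \<open>K^2 / N\<close> for the
      square.\<close>
    define L where "L = (\<bar>k\<bar> + 1) * K\<^sup>2 / N"
    have pointwise: "c * d\<^sup>2 * ?i (real M) (3 * real M) x - L * ?i 0 N x \<le> ?F x" for x
    proof (cases "x = 0")
      \<comment> \<open>Since \<open>ln 0 = 0\<close>, the origin is outside the open support of the
        bump; both shells miss it as well.\<close>
      case True
      then show ?thesis by (simp add: bump_outside)
    next
      case False
      define t where "t = ln (norm x)"
      have x: "norm x = exp t" using False by (simp add: t_def)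
      let ?b = "bump (t / N)" and ?b' = "bump_deriv (t / N) / N"
      have 1: "\<bar>k * ?b * ?b' + ?b'\<^sup>2\<bar> \<le> L"
      proof -
        have b': "\<bar>?b'\<bar> \<le> K / N" using K(3)[of "t / N"] N by (simp add: divide_right_mono)
        have "\<bar>k * ?b * ?b'\<bar> \<le> \<bar>k\<bar> * K * (K / N)"
          unfolding abs_mult using K b' by (intro mult_mono) (auto simp: abs_mult)
        moreover have "?b'\<^sup>2 \<le> (K / N)\<^sup>2" using b' using power_mono[OF b' abs_ge_zero, of 2] by (simp only: power2_abs)
        moreover have "(K / N)\<^sup>2 \<le> K\<^sup>2 / N" using N mult_left_mono[of 1 N "K * K"] by (simp add: power2_eq_square divide_simps)
        moreover have "L = \<bar>k\<bar> * K * (K / N) + K\<^sup>2 / N"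
          by (simp add: L_def power2_eq_square algebra_simps add_divide_distrib)
        moreover have "?b'\<^sup>2 \<ge> 0" by simp
        ultimately show ?thesis by linarith
      qed
      have 2: "d\<^sup>2 * indicator {M..<3 * real M} t \<le> ?b\<^sup>2"
      proof (cases "t \<in> {M..<3 * real M}")
        case True
        then have "t / N \<in> {1/4..3/4}" using that by (auto simp: N_def divide_simps)
        then show ?thesis using d True power_mono[of d "bump (t/N)" 2] by simp
      qed auto
      have "c * d\<^sup>2 * indicator {M..<3 * real M} t - L * indicator {0..<N} t
          \<le> c * ?b\<^sup>2 - k * ?b * ?b' - ?b'\<^sup>2"
      proof (cases "t \<in> {0..<N}")
        case True
        have "c * (d\<^sup>2 * indicator {M..<3 * real M} t) \<le> c * ?b\<^sup>2"
          using mult_left_mono[OF 2, of c] \<open>c > 0\<close> by simp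
        moreover have "L * indicator {0..<N} t = L" using True by simp
        ultimately show ?thesis using 1 unfolding mult.assoc[of c] by linarith
      next
        \<comment> \<open>For \<open>t\<close> outside the half-open range from 0 to
          \<open>N\<close>, both indicators and both bump factors vanish.\<close>
        case False
        then have "t / N \<notin> {0<..<1}" using N by (auto simp: divide_simps)
        then show ?thesis using False by (auto simp: bump_outside indicator_def N_def)
      qed
      from mult_left_mono[OF this nonneg[of x]]
      show ?thesis by (simp add: x indicator_def algebra_simps)
    qed
    have int_F: "integrable lborel ?F"
    proof (rule integrable_supported_in_annulus[where R = "exp N"])
      show "continuous_on (- {0}) ?F"
        by (intro continuous_intros cont continuous_on_compose2[OF continuous_on_bump[of UNIV]]
          continuous_on_compose2[OF continuous_on_bump_deriv[of UNIV]]) (use N in auto)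
      show "?F x = 0" if "norm x < 1" for x
      proof -
        have "ln (norm x) \<le> 0" using that by (cases "x = 0") auto
        then have "ln (norm x) / N \<notin> {0<..<1}" using N by (auto simp: divide_simps)
        then show ?thesis by (simp add: bump_outside)
      qed
      show "?F x = 0" if "norm x > exp N" for x
      proof -
        have "norm x > 0" using that exp_gt_zero[of N] by linarith
        then have "ln (norm x) > N" using that ln_less_cancel_iff[of "exp N" "norm x"] by simp
        then have "ln (norm x) / N \<notin> {0<..<1}" using N by (auto simp: divide_simps)
        then show ?thesis by (simp add: bump_outside)
      qed
    qed
    have "c * d\<^sup>2 * annulus_integral w (real M) (3 * real M) - L * annulus_integral w 0 N
        = integral\<^sup>L lborel (\<lambda>x. c * d\<^sup>2 * ?i (real M) (3 * real M) x - L * ?i 0 N x)"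
      unfolding annulus_integral_def
      by (subst Bochner_Integration.integral_diff;
          (intro integrable_mult_right annulus_integrand_integrable)?) (simp only: integral_mult_right_zero)
    also have "\<dots> \<le> integral\<^sup>L lborel ?F"
      by (intro integral_mono Bochner_Integration.integrable_diff integrable_mult_right annulus_integrand_integrable
        int_F pointwise)
    also have "\<dots> \<le> 0" using ineq[OF N(1)] by simp
    finally have "c * d\<^sup>2 * annulus_integral w (real M) (3 * real M) \<le> L * annulus_integral w 0 N" by simp
    moreover have "annulus_integral w (real M) (3 * real M) = 2 * real M * C"
      using annulus_integral_shift[of 0 "real M" "real (2 * M)"] annulus_integral_nat[of "2 * M"] by (simp add: C_def)
    moreover have "annulus_integral w 0 N = N * C"
      using annulus_integral_nat[of "4 * M"] N by (simp add: C_def)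
    moreover have "L * N = (\<bar>k\<bar> + 1) * K\<^sup>2" using N by (simp add: L_def)
    ultimately show ?thesis by (simp add: mult_ac)
  qed
  have "C = 0"
  proof (rule ccontr)
    assume "C \<noteq> 0"
    with \<open>C \<ge> 0\<close> have "C > 0" by simp
    let ?A = "2 * c * d\<^sup>2" and ?B = "(\<bar>k\<bar> + 1) * K\<^sup>2"
    have "?A > 0" using \<open>c > 0\<close> d by simp
    obtain M :: nat where M: "?B / ?A < real M" using reals_Archimedean2 by blast
    \<comment> \<open>Passing to \<open>M + 1\<close> secures the requirement
      \<open>M \<ge> 1\<close> of \<open>bound\<close>.\<close>
    have "?A * real (M + 1) \<le> ?B" using bound[of "M + 1"] \<open>C > 0\<close> by (simp add: mult_ac)
    moreover have "?B < ?A * real M" using M \<open>?A > 0\<close> by (simp add: pos_divide_less_eq mult.commute)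
    ultimately show False using \<open>?A > 0\<close> by (simp add: algebra_simps)
  qed
  then have ae: "AE x in lborel. indicator {x. exp 0 \<le> norm x \<and> norm x < exp 1} x *\<^sub>R w x = 0"
    using integral_nonneg_eq_0_iff_AE[OF annulus_integrand_integrable[of 0 1]] nonneg
    by (simp add: C_def annulus_integral_def)
  \<comment> \<open>\<open>V\<close> is open by continuity of \<open>w\<close> and null by the
    vanishing integral, hence empty.\<close>
  define V where "V = {x \<in> {x. 1 < norm x \<and> norm x < exp 1}. w x \<in> {0<..}}"
  have "open {x::'a. 1 < norm x \<and> norm x < exp 1}"
    by (intro open_Collect_conj open_Collect_less continuous_intros)
  moreover have "continuous_on {x. 1 < norm x \<and> norm x < exp 1} w"
    using cont by (rule continuous_on_subset) auto
  ultimately have "open V" unfolding V_def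
    using continuous_open_preimage[of "{x. 1 < norm x \<and> norm x < exp 1}" w "{0<..}"]
    by (simp add: vimage_def Int_def)
  have "V \<in> null_sets lborel"
    using ae \<open>open V\<close> by (subst AE_iff_null_sets) (auto simp: V_def indicator_def elim!: eventually_mono)
  then have "negligible V" using negligible_iff_null_sets null_sets_completionI by blast
  then have "V = {}" using open_not_negligible \<open>open V\<close> by blast
  \<comment> \<open>Rescaling to norm 2 lands inside the shell, as 1 < 2 < e.\<close>
  define y where "y = (2 / norm x0) *\<^sub>R x0"
  have "norm y = 2" using \<open>x0 \<noteq> 0\<close> by (simp add: y_def)
  moreover have "exp (1::real) > 2" using exp_lower_Taylor_quadratic[of "1::real"] by simp
  moreover have "y \<notin> V" using \<open>V = {}\<close> by simp
  ultimately have "w y \<le> 0" by (simp add: V_def not_less)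
  then have "w y = 0" using nonneg[of y] by simp
  then show ?thesis using homogeneous[of "2 / norm x0" x0] \<open>x0 \<noteq> 0\<close> by (simp add: y_def)
qed

end

section \<open>Stable homogeneous solutions\<close>

text \<open>The integrand is the divergence of \<open>g^2 v \<nabla>v\<close>, and the partial
  derivatives of its compactly supported components integrate to zero.\<close>

lemma integral_energy_identity:
  fixes v g :: "real^'n::finite \<Rightarrow> real"
  assumes v: "C_k_on 2 (- {0}) v" and g: "C_k_on 1 (- {0}) g"
    and zero: "\<And>x. norm x < 1 \<Longrightarrow> g x = 0" "\<And>x. norm x > R \<Longrightarrow> g x = 0"
  shows "integral\<^sup>L lborel (\<lambda>x. (g x)\<^sup>2 * grad_sq v x
    + 2 * v x * g x * (\<Sum>j\<in>UNIV. partial j g x * partial j v x) + (g x)\<^sup>2 * v x * laplacian v x) = 0"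
proof -
  let ?f = "\<lambda>j x. (v x * (g x * g x)) * partial j v x"
  have v1: "C_k_on 1 (- {0}) v" and v2: "C_k_on 1 (- {0}) (partial j v)" for j
    using v C_k_on_SucD[of 1 "- {0}" v] by (simp_all add: numeral_2_eq_2)
  have d: "v differentiable (at x)" "g differentiable (at x)" "partial j v differentiable (at x)"
    if "x \<noteq> 0" for x j
    using v1 v2[of j] g that by simp_all
  have C: "C_k_on 1 UNIV (?f j)" for j
    by (rule C_k_on_UNIV_if_zero) (auto intro!: C_k_on_mult v1 v2 g simp: zero simp del: One_nat_def)
  have int: "integrable lborel (partial j (?f j))" for j
  proof (rule integrable_supported_in_cball)
    show "continuous_on UNIV (partial j (?f j))"
      using C[of j] by simp
    fix x :: "real^'n" assume x: "norm x > R"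
    have "open {x::real^'n. norm x > R}" by (intro open_Collect_less continuous_intros)
    then show "partial j (?f j) x = 0" by (rule partial_eq_0) (use x zero(2) in auto)
  qed
  have "(\<lambda>x. (g x)\<^sup>2 * grad_sq v x
    + 2 * v x * g x * (\<Sum>j\<in>UNIV. partial j g x * partial j v x) + (g x)\<^sup>2 * v x * laplacian v x)
    = (\<lambda>x. \<Sum>j\<in>UNIV. partial j (?f j) x)"
  proof
    fix x :: "real^'n"
    show "(g x)\<^sup>2 * grad_sq v x
      + 2 * v x * g x * (\<Sum>j\<in>UNIV. partial j g x * partial j v x) + (g x)\<^sup>2 * v x * laplacian v x
      = (\<Sum>j\<in>UNIV. partial j (?f j) x)"
    proof (cases "x = 0")
      case True
      \<comment> \<open>At the origin \<open>v\<close> may be irregular, but \<open>g\<close>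
        vanishes on the whole unit ball.\<close>
      have "partial j (?f j) x = 0" for j
        using True by (intro partial_eq_0[of "ball 0 1"]) (auto simp: zero)
      then show ?thesis using True by (simp add: zero)
    next
      case False
      have "partial j (?f j) x = (g x)\<^sup>2 * (partial j v x)\<^sup>2
          + 2 * v x * g x * (partial j g x * partial j v x) + (g x)\<^sup>2 * v x * partial j (partial j v) x" for j
        using d[OF False] by (simp add: partial_mult power2_eq_square algebra_simps)
      then show ?thesis
        by (simp add: grad_sq_def laplacian_def sum.distrib sum_distrib_left)
    qed
  qed
  then have "integral\<^sup>L lborel (\<lambda>x. (g x)\<^sup>2 * grad_sq v x
    + 2 * v x * g x * (\<Sum>j\<in>UNIV. partial j g x * partial j v x) + (g x)\<^sup>2 * v x * laplacian v x)
    = (\<Sum>j\<in>UNIV. integral\<^sup>L lborel (partial j (?f j)))"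
    using int by (simp add: Bochner_Integration.integral_sum)
  also have "\<dots> = 0"
    using integral_partial_eq_0[OF C, of R] zero(2) by (intro sum.neutral) auto
  finally show ?thesis .
qed

text \<open>Differentiate the scaling relation in \<open>c\<close> at \<open>c = 1\<close>.\<close>

lemma Euler_homogeneous:
  fixes v :: "real^'n::finite \<Rightarrow> real"
  assumes "v differentiable (at x)" "\<And>c. c > 0 \<Longrightarrow> v (c *\<^sub>R x) = c powr a * v x"
  shows "(\<Sum>j\<in>UNIV. x $ j * partial j v x) = a * v x"
proof -
  have "((\<lambda>c. c *\<^sub>R x) has_derivative (\<lambda>h. h *\<^sub>R x)) (at 1)"
    by (auto intro!: derivative_eq_intros)
  moreover have "v differentiable (at (1 *\<^sub>R x))" using assms(1) by simp
  ultimately have "((\<lambda>c. v (c *\<^sub>R x)) has_derivative (\<lambda>h. \<Sum>j\<in>UNIV. (h *\<^sub>R x) $ j * partial j v (1 *\<^sub>R x))) (at 1)"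
    by (intro has_derivative_compose[OF _ has_derivative_partial])
  then have "((\<lambda>c. v (c *\<^sub>R x)) has_real_derivative (\<Sum>j\<in>UNIV. x $ j * partial j v x)) (at 1)"
    by (simp add: has_field_derivative_def mult.assoc mult_commute_abs flip: sum_distrib_left)
  then have "((\<lambda>c. c powr a * v x) has_real_derivative (\<Sum>j\<in>UNIV. x $ j * partial j v x)) (at 1)"
    by (rule has_field_derivative_transform_within_open[where S = "{0<..}"]) (use assms(2) in auto)
  moreover have "((\<lambda>c. c powr a * v x) has_real_derivative a * v x) (at 1)"
    by (auto intro!: derivative_eq_intros)
  ultimately show ?thesis by (rule DERIV_unique)
qed

text \<open>The support lies in the closed shell \<open>1 \<le> norm x \<le> R\<close>, which is
  compact and misses the origin.\<close>

lemma test_funI: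
  fixes \<phi> :: "real^'n::finite \<Rightarrow> real"
  assumes "\<And>k. C_k_on k (- {0}) \<phi>" "\<And>x. norm x < 1 \<Longrightarrow> \<phi> x = 0" "\<And>x. norm x > R \<Longrightarrow> \<phi> x = 0"
  shows "test_fun \<phi>"
proof -
  have "closed (cball 0 R - ball (0::real^'n) 1)" by (intro closed_Diff) auto
  moreover have "{x. \<phi> x \<noteq> 0} \<subseteq> cball 0 R - ball 0 1"
    using assms(2,3) by (auto simp: not_less) (meson not_le)+
  ultimately have sub: "closure {x. \<phi> x \<noteq> 0} \<subseteq> cball 0 R - ball 0 1"
    by (rule closure_minimal[rotated])
  then have "bounded (closure {x. \<phi> x \<noteq> 0})"
    using bounded_subset bounded_cball by (metis Diff_subset)
  then show ?thesis
    using assms(1,2) sub C_k_on_UNIV_if_zero[of _ \<phi>]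
    by (auto simp: test_fun_def C_inf_on_def compact_eq_bounded_closed)
qed

lemma norm_vec_sq: "(norm x)\<^sup>2 = (\<Sum>i\<in>UNIV. (x $ i)\<^sup>2)" for x :: "real^'m::finite"
  unfolding power2_norm_eq_inner inner_vec_def by (simp add: power2_eq_square)

text \<open>At \<open>r = 0\<close> both sides vanish because \<open>0 powr a = 0\<close> for every
  \<open>a\<close>, so zeros of \<open>u\<close> are covered.\<close>

lemma powr_diff_2_mult_square: "r \<ge> 0 \<Longrightarrow> r powr (q - 2) * r\<^sup>2 = r powr q" for r :: real
  by (cases "r = 0") (auto simp: powr_diff)

context
  fixes u :: "real^'n::finite \<Rightarrow> real^'m::finite" and \<alpha> p :: real
  assumes p: "p > 1"
    and smooth: "\<And>i k. C_k_on k (- {0}) (\<lambda>x. u x $ i)"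
    and homogeneous: "\<And>c x. c > 0 \<Longrightarrow> x \<noteq> 0 \<Longrightarrow> u (c *\<^sub>R x) = c powr (- \<alpha>) *\<^sub>R u x"
    and equation: "\<And>i x. x \<noteq> 0 \<Longrightarrow> - laplacian (\<lambda>y. u y $ i) x = norm (u x) powr (p - 1) * (u x $ i)"
    and stab: "stable p u"
begin

lemma continuous_on_u: "continuous_on (- {0}) u"
  using continuous_on_vec_lambda[of "- {0}" "\<lambda>i x. u x $ i"] C_k_on_imp_continuous_on[OF smooth] by simp

text \<open>\<open>G\<close> encodes that \<open>g\<close> is radial: it is the radial derivative of
  \<open>g\<close> divided by the radius. The integral \<open>I\<close> of
  \<open>|u|^(p+1) g^2\<close> is bounded above by stability and below by the equation; eliminating
  it leaves an inequality in \<open>|u|^2\<close> alone.\<close>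

lemma radial_test_inequality:
  fixes g G :: "real^'n \<Rightarrow> real"
  assumes g: "\<And>k. C_k_on k (- {0}) g"
    and zero: "\<And>x. norm x < 1 \<Longrightarrow> g x = 0" "\<And>x. norm x > R \<Longrightarrow> g x = 0"
      "\<And>x. norm x < 1 \<Longrightarrow> G x = 0" "\<And>x. norm x > R \<Longrightarrow> G x = 0"
    and contG: "continuous_on (- {0}) G"
    and grad: "\<And>x j. x \<noteq> 0 \<Longrightarrow> partial j g x = G x * x $ j"
  shows "integral\<^sup>L lborel (\<lambda>x. (norm (u x))\<^sup>2 * ((p - 1) * (\<alpha>\<^sup>2 * (g x)\<^sup>2 / (norm x)\<^sup>2 - 2 * \<alpha> * g x * G x)
    - (G x)\<^sup>2 * (norm x)\<^sup>2)) \<le> 0"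
proof -
  let ?v = "\<lambda>i x. u x $ i"
  let ?P = "\<lambda>x. norm (u x) powr (p - 1)"
  note cg = C_k_on_imp_continuous_on[OF g[of 0]]
  note cv = C_k_on_imp_continuous_on[OF smooth]
  have cP: "continuous_on (- {0}) ?P"
    using p by (intro continuous_on_powr' continuous_on_norm continuous_on_u continuous_on_const) auto
  have cgrad: "continuous_on (- {0}) (grad_sq (?v i))" for i
    unfolding grad_sq_def[abs_def]
    using C_k_on_imp_continuous_on[OF C_k_on_partial[OF smooth[of "Suc 0" i]]]
    by (intro continuous_intros)
  note cont = continuous_intros cg cv cP cgrad contG continuous_on_u
  have radial: "(\<Sum>j\<in>UNIV. x $ j * partial j (?v i) x) = - \<alpha> * ?v i x" if "x \<noteq> 0" for x i
    using that homogeneous C_k_on_differentiable[OF smooth[of "Suc 0" i]] by (intro Euler_homogeneous) auto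
  \<comment> \<open>As the gradient of \<open>g\<close> is parallel to \<open>x\<close>, only the
    radial derivative of \<open>u_i\<close> enters, and the Euler relation evaluates it.\<close>
  have cross: "g x * (\<Sum>j\<in>UNIV. partial j g x * partial j (?v i) x) = - \<alpha> * g x * G x * ?v i x" for x i
  proof (cases "x = 0")
    case False
    have "(\<Sum>j\<in>UNIV. partial j g x * partial j (?v i) x) = G x * (\<Sum>j\<in>UNIV. x $ j * partial j (?v i) x)"
      by (simp add: grad[OF False] sum_distrib_left mult.assoc)
    then show ?thesis by (simp add: radial[OF False])
  qed (simp add: zero)

  have i1: "integrable lborel (\<lambda>x. (g x)\<^sup>2 * grad_sq (?v i) x - 2 * \<alpha> * (?v i x)\<^sup>2 * g x * G x)" for i
    by (intro integrable_supported_in_annulus[where R = R] cont) (auto simp: zero)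
  have i2: "integrable lborel (\<lambda>x. ?P x * (?v i x * g x)\<^sup>2)" for i
    by (intro integrable_supported_in_annulus[where R = R] cont) (auto simp: zero)
  have i3: "integrable lborel (\<lambda>x. (?v i x)\<^sup>2 * (G x)\<^sup>2 * (norm x)\<^sup>2)" for i
    by (intro integrable_supported_in_annulus[where R = R] cont) (auto simp: zero)
  \<comment> \<open>This is the energy identity with the laplacian replaced through the
    equation.\<close>
  have weak: "integral\<^sup>L lborel (\<lambda>x. (g x)\<^sup>2 * grad_sq (?v i) x - 2 * \<alpha> * (?v i x)\<^sup>2 * g x * G x)
      = integral\<^sup>L lborel (\<lambda>x. ?P x * (?v i x * g x)\<^sup>2)" for i
  proof -
    have "(g x)\<^sup>2 * grad_sq (?v i) x
        + 2 * ?v i x * g x * (\<Sum>j\<in>UNIV. partial j g x * partial j (?v i) x) + (g x)\<^sup>2 * ?v i x * laplacian (?v i) x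
      = ((g x)\<^sup>2 * grad_sq (?v i) x - 2 * \<alpha> * (?v i x)\<^sup>2 * g x * G x) - ?P x * (?v i x * g x)\<^sup>2" for x
    proof (cases "x = 0")
      case False
      have "laplacian (?v i) x = - (?P x * ?v i x)" using equation[OF False, of i] by linarith
      moreover have "2 * ?v i x * g x * (\<Sum>j\<in>UNIV. partial j g x * partial j (?v i) x)
          = 2 * ?v i x * (- \<alpha> * g x * G x * ?v i x)" unfolding cross[symmetric] by simp
      ultimately show ?thesis by (simp add: power2_eq_square)
    qed (simp add: zero)
    with integral_energy_identity[OF smooth[of 2 i] g[of 1] zero(1,2)]
    have "integral\<^sup>L lborel (\<lambda>x. ((g x)\<^sup>2 * grad_sq (?v i) x - 2 * \<alpha> * (?v i x)\<^sup>2 * g x * G x)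
        - ?P x * (?v i x * g x)\<^sup>2) = 0" by simp
    then show ?thesis using i1 i2 by simp
  qed

  \<comment> \<open>The bracket is the integrand of \<open>weak\<close>, so that its integral later
    cancels against the first term of stability.\<close>
  have grad_prod: "grad_sq (\<lambda>x. ?v i x * g x) x
      = ((g x)\<^sup>2 * grad_sq (?v i) x - 2 * \<alpha> * (?v i x)\<^sup>2 * g x * G x) + (?v i x)\<^sup>2 * (G x)\<^sup>2 * (norm x)\<^sup>2" for i x
  proof (cases "x = 0")
    case True
    then have "partial j (\<lambda>x. ?v i x * g x) x = 0" for j
      by (intro partial_eq_0[of "ball 0 1"]) (auto simp: zero)
    then show ?thesis using True by (simp add: grad_sq_def zero)
  next
    case False
    have "partial j (\<lambda>x. ?v i x * g x) x = ?v i x * partial j g x + partial j (?v i) x * g x" for j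
      using False by (intro partial_mult C_k_on_differentiable[OF smooth] C_k_on_differentiable[OF g]) auto
    then have "grad_sq (\<lambda>x. ?v i x * g x) x = (g x)\<^sup>2 * grad_sq (?v i) x
        + 2 * ?v i x * (g x * (\<Sum>j\<in>UNIV. partial j g x * partial j (?v i) x))
        + (?v i x)\<^sup>2 * (\<Sum>j\<in>UNIV. (partial j g x)\<^sup>2)"
      by (simp add: grad_sq_def power2_eq_square algebra_simps sum.distrib sum_distrib_left)
    also have "(\<Sum>j\<in>UNIV. (partial j g x)\<^sup>2) = (G x)\<^sup>2 * (norm x)\<^sup>2"
      by (simp add: grad[OF False] norm_vec_sq power_mult_distrib sum_distrib_left)
    finally show ?thesis unfolding cross by (simp add: power2_eq_square)
  qed

  let ?T = "\<lambda>i j x. norm (u x) powr (p - 3) * ?v i x * ?v j x * (?v i x * g x) * (?v j x * g x)"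
  have sq: "norm (u x) powr (p - 3) * ((norm (u x))\<^sup>2)\<^sup>2 = ?P x * (norm (u x))\<^sup>2" for x
    using powr_diff_2_mult_square[of "norm (u x)" "p - 1"] by (auto simp: power2_eq_square)
  \<comment> \<open>For \<open>p < 3\<close> the factor \<open>norm (u x) powr (p - 3)\<close> need
    not be continuous at zeros of \<open>u\<close>. Domination by the integrable
    \<open>|u|^(p+1) g^2\<close> takes the place of continuity.\<close>
  have int_T: "integrable lborel (?T i j)" for i j
  proof (rule Bochner_Integration.integrable_bound)
    show "integrable lborel (\<lambda>x. \<Sum>i\<in>UNIV. ?P x * (?v i x * g x)\<^sup>2)"
      by (intro Bochner_Integration.integrable_sum i2)
    \<comment> \<open>The value \<open>u 0\<close> is arbitrary; cutting out the origin makes each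
      factor measurable and leaves the product unchanged, as \<open>g 0 = 0\<close>.\<close>
    let ?r = "\<lambda>x. indicator (- {0}) x *\<^sub>R norm (u x)" and ?w = "\<lambda>i x. indicator (- {0}) x *\<^sub>R ?v i x"
      and ?g = "\<lambda>x. indicator (- {0}) x *\<^sub>R g x"
    have "?r \<in> borel_measurable borel" "?w i \<in> borel_measurable borel" "?w j \<in> borel_measurable borel"
      "?g \<in> borel_measurable borel"
      by (intro borel_measurable_continuous_on_indicator continuous_on_norm continuous_on_u cg cv; simp)+
    then have "(\<lambda>x. ?r x powr (p - 3) * ?w i x * ?w j x * (?w i x * ?g x) * (?w j x * ?g x)) \<in> borel_measurable borel"
      by (intro borel_measurable_times powr_real_measurable borel_measurable_const)
    also have "(\<lambda>x. ?r x powr (p - 3) * ?w i x * ?w j x * (?w i x * ?g x) * (?w j x * ?g x)) = ?T i j"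
      by (auto simp: fun_eq_iff indicator_def zero)
    finally show "?T i j \<in> borel_measurable lborel" by simp
    show "AE x in lborel. norm (?T i j x) \<le> norm (\<Sum>i\<in>UNIV. ?P x * (?v i x * g x)\<^sup>2)"
    proof (intro AE_I2)
      fix x
      have "norm (?T i j x) = norm (u x) powr (p - 3) * ((?v i x)\<^sup>2 * (?v j x)\<^sup>2) * (g x)\<^sup>2"
        by (simp add: abs_mult power2_eq_square mult_ac)
      also have "\<dots> \<le> norm (u x) powr (p - 3) * ((norm (u x))\<^sup>2 * (norm (u x))\<^sup>2) * (g x)\<^sup>2"
        using power_mono[OF component_le_norm_cart abs_ge_zero, of "u x" _ 2]
        by (intro mult_left_mono mult_right_mono mult_mono) auto
      also have "\<dots> = ?P x * (norm (u x))\<^sup>2 * (g x)\<^sup>2"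
        using sq[of x] by (simp add: power2_eq_square)
      also have "\<dots> = (\<Sum>i\<in>UNIV. ?P x * (?v i x * g x)\<^sup>2)"
        by (simp add: norm_vec_sq power_mult_distrib sum_distrib_left sum_distrib_right mult.assoc)
      also have "\<dots> \<le> norm (\<Sum>i\<in>UNIV. ?P x * (?v i x * g x)\<^sup>2)" by simp
      finally show "norm (?T i j x) \<le> norm (\<Sum>i\<in>UNIV. ?P x * (?v i x * g x)\<^sup>2)" .
    qed
  qed
  \<comment> \<open>For the test functions \<open>u_i g\<close> the double sum factors through
    \<open>(|u|^2)^2\<close>, so the coupling term of stability is the same integral as the first
    term.\<close>
  have sum_T: "(\<Sum>i\<in>UNIV. \<Sum>j\<in>UNIV. ?T i j x) = (\<Sum>i\<in>UNIV. ?P x * (?v i x * g x)\<^sup>2)" for x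
  proof -
    have "(\<Sum>i\<in>UNIV. \<Sum>j\<in>UNIV. ?T i j x)
        = norm (u x) powr (p - 3) * (g x)\<^sup>2 * ((\<Sum>i\<in>UNIV. (?v i x)\<^sup>2) * (\<Sum>j\<in>UNIV. (?v j x)\<^sup>2))"
      by (subst sum_product) (simp add: sum_distrib_left power2_eq_square mult_ac)
    also have "\<dots> = (norm (u x) powr (p - 3) * ((norm (u x))\<^sup>2)\<^sup>2) * (g x)\<^sup>2"
      unfolding norm_vec_sq by (simp add: power2_eq_square[of "sum _ _"])
    also have "\<dots> = ?P x * (norm (u x))\<^sup>2 * (g x)\<^sup>2"
      unfolding sq ..
    also have "\<dots> = (\<Sum>i\<in>UNIV. ?P x * (?v i x * g x)\<^sup>2)"
      by (simp add: norm_vec_sq power_mult_distrib sum_distrib_left sum_distrib_right mult.assoc)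
    finally show ?thesis .
  qed
  define I where "I = (\<Sum>i\<in>UNIV. integral\<^sup>L lborel (\<lambda>x. ?P x * (?v i x * g x)\<^sup>2))"
  have I_eq: "I = integral\<^sup>L lborel (\<lambda>x. \<Sum>i\<in>UNIV. ?P x * (?v i x * g x)\<^sup>2)"
    unfolding I_def using i2 by (simp add: Bochner_Integration.integral_sum)
  have "test_fun (\<lambda>x. ?v i x * g x)" for i
    by (rule test_funI[where R = R]) (auto intro!: C_k_on_mult smooth g simp: zero)
  with stab have "I + (p - 1) * (\<Sum>i\<in>UNIV. \<Sum>j\<in>UNIV. integral\<^sup>L lborel (?T i j))
      \<le> (\<Sum>i\<in>UNIV. integral\<^sup>L lborel (grad_sq (\<lambda>x. ?v i x * g x)))"
    unfolding stable_def I_def by (elim allE[where x = "\<lambda>i x. ?v i x * g x"]) simp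
  moreover have "(\<Sum>i\<in>UNIV. \<Sum>j\<in>UNIV. integral\<^sup>L lborel (?T i j)) = I"
  proof -
    have "(\<Sum>i\<in>UNIV. \<Sum>j\<in>UNIV. integral\<^sup>L lborel (?T i j)) = integral\<^sup>L lborel (\<lambda>x. \<Sum>i\<in>UNIV. \<Sum>j\<in>UNIV. ?T i j x)"
      using int_T by (subst Bochner_Integration.integral_sum; (intro Bochner_Integration.integrable_sum int_T)?)
        (subst Bochner_Integration.integral_sum; simp)
    then show ?thesis by (simp only: sum_T I_eq)
  qed
  moreover have "(\<Sum>i\<in>UNIV. integral\<^sup>L lborel (grad_sq (\<lambda>x. ?v i x * g x)))
      = I + integral\<^sup>L lborel (\<lambda>x. (norm (u x))\<^sup>2 * (G x)\<^sup>2 * (norm x)\<^sup>2)"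
  proof -
    have "integral\<^sup>L lborel (grad_sq (\<lambda>x. ?v i x * g x)) = integral\<^sup>L lborel (\<lambda>x. ?P x * (?v i x * g x)\<^sup>2)
        + integral\<^sup>L lborel (\<lambda>x. (?v i x)\<^sup>2 * (G x)\<^sup>2 * (norm x)\<^sup>2)" for i
      unfolding grad_prod weak[symmetric] using i1 i3 by (rule Bochner_Integration.integral_add)
    moreover have "(\<Sum>i\<in>UNIV. integral\<^sup>L lborel (\<lambda>x. (?v i x)\<^sup>2 * (G x)\<^sup>2 * (norm x)\<^sup>2))
        = integral\<^sup>L lborel (\<lambda>x. (norm (u x))\<^sup>2 * (G x)\<^sup>2 * (norm x)\<^sup>2)"
      unfolding norm_vec_sq[of "u _"] sum_distrib_right
      using i3 by (subst Bochner_Integration.integral_sum) auto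
    ultimately show ?thesis by (simp add: I_def sum.distrib)
  qed
  \<comment> \<open>Stability has \<open>I + (p - 1) * I\<close> on the left and \<open>I\<close>
    plus the remaining integral on the right; one \<open>I\<close> cancels.\<close>
  ultimately have stability: "(p - 1) * I \<le> integral\<^sup>L lborel (\<lambda>x. (norm (u x))\<^sup>2 * (G x)\<^sup>2 * (norm x)\<^sup>2)"
    by simp

  have i4: "integrable lborel (\<lambda>x. (norm (u x))\<^sup>2 * (\<alpha>\<^sup>2 * (g x)\<^sup>2 / (norm x)\<^sup>2 - 2 * \<alpha> * g x * G x))"
    by (intro integrable_supported_in_annulus[where R = R] cont) (auto simp: zero)
  have i5: "integrable lborel (\<lambda>x. (norm (u x))\<^sup>2 * (G x)\<^sup>2 * (norm x)\<^sup>2)"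
    by (intro integrable_supported_in_annulus[where R = R] cont) (auto simp: zero)
  have "integral\<^sup>L lborel (\<lambda>x. (norm (u x))\<^sup>2 * (\<alpha>\<^sup>2 * (g x)\<^sup>2 / (norm x)\<^sup>2 - 2 * \<alpha> * g x * G x))
      \<le> integral\<^sup>L lborel (\<lambda>x. \<Sum>i\<in>UNIV. (g x)\<^sup>2 * grad_sq (?v i) x - 2 * \<alpha> * (?v i x)\<^sup>2 * g x * G x)"
  proof (intro integral_mono i4 Bochner_Integration.integrable_sum i1)
    fix x
    \<comment> \<open>By Cauchy-Schwarz the gradient is at least as large as the radial derivative,
      which is \<open>- \<alpha> * u_i / r\<close> by the Euler relation.\<close>
    have "\<alpha>\<^sup>2 * (?v i x)\<^sup>2 * (g x)\<^sup>2 / (norm x)\<^sup>2 \<le> (g x)\<^sup>2 * grad_sq (?v i) x" for i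
    proof (cases "x = 0")
      case False
      have "\<alpha>\<^sup>2 * (?v i x)\<^sup>2 = (\<Sum>j\<in>UNIV. x $ j * partial j (?v i) x)\<^sup>2"
        by (simp add: radial[OF False] power_mult_distrib)
      also have "\<dots> \<le> (norm x)\<^sup>2 * grad_sq (?v i) x"
        unfolding norm_vec_sq grad_sq_def by (rule Cauchy_Schwarz_ineq_sum)
      finally have "\<alpha>\<^sup>2 * (?v i x)\<^sup>2 / (norm x)\<^sup>2 \<le> grad_sq (?v i) x"
        using False by (simp add: divide_simps mult.commute)
      from mult_left_mono[OF this, of "(g x)\<^sup>2"] show ?thesis by (simp add: mult_ac)
    qed (simp add: zero)
    then have "(\<Sum>i\<in>UNIV. \<alpha>\<^sup>2 * (?v i x)\<^sup>2 * (g x)\<^sup>2 / (norm x)\<^sup>2 - 2 * \<alpha> * (?v i x)\<^sup>2 * g x * G x)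
        \<le> (\<Sum>i\<in>UNIV. (g x)\<^sup>2 * grad_sq (?v i) x - 2 * \<alpha> * (?v i x)\<^sup>2 * g x * G x)"
      by (intro sum_mono diff_right_mono)
    moreover have "(\<Sum>i\<in>UNIV. \<alpha>\<^sup>2 * (?v i x)\<^sup>2 * (g x)\<^sup>2 / (norm x)\<^sup>2 - 2 * \<alpha> * (?v i x)\<^sup>2 * g x * G x)
        = (norm (u x))\<^sup>2 * (\<alpha>\<^sup>2 * (g x)\<^sup>2 / (norm x)\<^sup>2 - 2 * \<alpha> * g x * G x)"
      unfolding norm_vec_sq[of "u x"] sum_distrib_right by (intro sum.cong) (auto simp: algebra_simps)
    ultimately show "(norm (u x))\<^sup>2 * (\<alpha>\<^sup>2 * (g x)\<^sup>2 / (norm x)\<^sup>2 - 2 * \<alpha> * g x * G x)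
        \<le> (\<Sum>i\<in>UNIV. (g x)\<^sup>2 * grad_sq (?v i) x - 2 * \<alpha> * (?v i x)\<^sup>2 * g x * G x)" by simp
  qed
  also have "\<dots> = I"
    unfolding I_def weak[symmetric] using i1 by (subst Bochner_Integration.integral_sum) auto
  finally have "(p - 1) * integral\<^sup>L lborel (\<lambda>x. (norm (u x))\<^sup>2 * (\<alpha>\<^sup>2 * (g x)\<^sup>2 / (norm x)\<^sup>2 - 2 * \<alpha> * g x * G x))
      \<le> (p - 1) * I" using p by simp
  with stability have "(p - 1) * integral\<^sup>L lborel (\<lambda>x. (norm (u x))\<^sup>2 * (\<alpha>\<^sup>2 * (g x)\<^sup>2 / (norm x)\<^sup>2 - 2 * \<alpha> * g x * G x))
      - integral\<^sup>L lborel (\<lambda>x. (norm (u x))\<^sup>2 * (G x)\<^sup>2 * (norm x)\<^sup>2) \<le> 0" by linarith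
  also have "(p - 1) * integral\<^sup>L lborel (\<lambda>x. (norm (u x))\<^sup>2 * (\<alpha>\<^sup>2 * (g x)\<^sup>2 / (norm x)\<^sup>2 - 2 * \<alpha> * g x * G x))
      - integral\<^sup>L lborel (\<lambda>x. (norm (u x))\<^sup>2 * (G x)\<^sup>2 * (norm x)\<^sup>2)
    = integral\<^sup>L lborel (\<lambda>x. (p - 1) * ((norm (u x))\<^sup>2 * (\<alpha>\<^sup>2 * (g x)\<^sup>2 / (norm x)\<^sup>2 - 2 * \<alpha> * g x * G x))
      - (norm (u x))\<^sup>2 * (G x)\<^sup>2 * (norm x)\<^sup>2)"
    using integrable_mult_right[OF i4, of "p - 1"] i5
    by (subst Bochner_Integration.integral_diff) (simp_all only: integral_mult_right_zero)
  finally show ?thesis by (simp add: algebra_simps)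
qed

end

text \<open>The hypothesis \<open>supercritical\<close> says that the constant \<open>c\<close> in
  front of \<open>\<eta>^2\<close> is positive. Stretched logarithmic cut-offs turn the radial
  inequality into the hypothesis \<open>ineq\<close> of
  \<open>homogeneous_weight_eq_0\<close>.\<close>

lemma stable_homogeneous_solution_eq_0:
  fixes u :: "real^'n::finite \<Rightarrow> real^'m::finite"
  assumes p: "p > 1"
    and smooth: "\<And>i k. C_k_on k (- {0}) (\<lambda>x. u x $ i)"
    and homogeneous: "\<And>c x. c > 0 \<Longrightarrow> x \<noteq> 0 \<Longrightarrow> u (c *\<^sub>R x) = c powr (- \<alpha>) *\<^sub>R u x"
    and equation: "\<And>i x. x \<noteq> 0 \<Longrightarrow> - laplacian (\<lambda>y. u y $ i) x = norm (u x) powr (p - 1) * (u x $ i)"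
    and stab: "stable p u"
    and supercritical: "(p - 1) * \<alpha> * (real CARD('n) - 2 - \<alpha>) > (\<alpha> - (real CARD('n) - 2) / 2)\<^sup>2"
    and "x \<noteq> 0"
  shows "u x = 0"
proof -
  let ?n = "real CARD('n)"
  \<comment> \<open>Chosen so that \<open>|u|^2 r^(2b - 2)\<close> has degree
    \<open>- 2\<alpha> + 2b - 2 = - n\<close>.\<close>
  define b where "b = \<alpha> - (?n - 2) / 2"
  define w where "w x = norm x powr (2 * \<alpha> - ?n) * (norm (u x))\<^sup>2" for x
  define c where "c = (p - 1) * \<alpha> * (?n - 2 - \<alpha>) - b\<^sup>2"
  have cont: "continuous_on (- {0}) w"
    unfolding w_def[abs_def] using continuous_on_u[OF p smooth homogeneous equation stab]
    by (intro continuous_intros) auto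
  have "w x = 0"
  proof (rule homogeneous_weight_eq_0[OF cont])
    fix s :: real and x :: "real^'n" assume "s > 0" "x \<noteq> 0"
    have "s powr (2 * \<alpha> - ?n) * (s powr (- \<alpha>))\<^sup>2 * s ^ CARD('n) = s powr ((2 * \<alpha> - ?n) + (- \<alpha> + - \<alpha>) + ?n)"
      using \<open>s > 0\<close> by (simp only: powr_add power2_eq_square powr_realpow)
    then have "s powr (2 * \<alpha> - ?n) * (s powr (- \<alpha>))\<^sup>2 * s ^ CARD('n) = 1"
      using \<open>s > 0\<close> by simp
    then show "s ^ DIM(real^'n) * w (s *\<^sub>R x) = w x"
      using \<open>s > 0\<close> by (simp add: w_def homogeneous[OF \<open>s > 0\<close> \<open>x \<noteq> 0\<close>] powr_mult power_mult_distrib)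
        (metis (no_types, lifting) mult.assoc mult.commute mult.left_commute mult_1)
  next
    show "w x \<ge> 0" for x by (simp add: w_def)
    show "c > 0" using supercritical by (simp add: c_def b_def)
    show "x \<noteq> 0" by fact
  next
    fix N :: real assume N: "N \<ge> 1"
    let ?\<eta> = "\<lambda>x::real^'n. bump (ln (norm x) / N)" and ?\<eta>' = "\<lambda>x::real^'n. bump_deriv (ln (norm x) / N) / N"
    define g where "g x = norm x powr b * ?\<eta> x" for x
    \<comment> \<open>This is \<open>g'(r) / r\<close>; the factor \<open>1 / N\<close> from the
      chain rule is part of \<open>?\<eta>'\<close>.\<close>
    define G where "G x = norm x powr (b - 2) * (b * ?\<eta> x + ?\<eta>' x)" for x
    have outside: "ln (norm x) / N \<notin> {0<..<1}" if "norm x < 1 \<or> norm x > exp N" for x :: "real^'n"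
    proof (cases "norm x < 1")
      case True
      then have "ln (norm x) \<le> 0" by (cases "x = 0") auto
      then show ?thesis using N by (auto simp: divide_simps)
    next
      case False
      moreover have "norm x > 0" using False by linarith
      ultimately have "ln (norm x) > N" using that ln_less_cancel_iff[of "exp N" "norm x"] by auto
      then show ?thesis using N by (auto simp: divide_simps)
    qed
    have g_smooth: "C_k_on k (- {0}) g" for k
    proof -
      \<comment> \<open>Differences and quotients are spelled as sums and products to fit the
        closure rules of \<open>C_k_on\<close>.\<close>
      have 1: "C_k_on k (- {0}) (\<lambda>x::real^'n. ln (norm x) * (1 / N))"
        by (intro C_k_on_mult C_k_on_ln_norm C_k_on_const) auto
      then have "C_k_on k (- {0}) (\<lambda>x::real^'n. 1 + ln (norm x) * (1 / N) * (- 1))"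
        by (intro C_k_on_add C_k_on_mult[OF _ 1] C_k_on_const) auto
      with 1 have "C_k_on k (- {0}) (\<lambda>x::real^'n. norm x powr b
          * (flat 0 (ln (norm x) * (1 / N)) * flat 0 (1 + ln (norm x) * (1 / N) * (- 1))))"
        by - (rule C_k_on_mult[OF _ C_k_on_norm_powr C_k_on_mult[OF _ C_k_on_flat C_k_on_flat]], (assumption | intro open_Compl closed_singleton)+)
      then show ?thesis by (simp add: g_def[abs_def] bump_def)
    qed
    have G_cont: "continuous_on (- {0}) G"
      unfolding G_def[abs_def]
      by (intro continuous_intros continuous_on_compose2[OF continuous_on_bump[of UNIV]]
          continuous_on_compose2[OF continuous_on_bump_deriv[of UNIV]]) (use N in auto)
    have grad: "partial j g x = G x * x $ j" if "x \<noteq> 0" for x j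
    proof -
      define r where "r = norm x"
      have r: "r > 0" using that by (simp add: r_def)
      have "((\<lambda>r. ln r / N) has_real_derivative 1 / (r * N)) (at r)"
        using r N by (auto intro!: derivative_eq_intros)
      from DERIV_chain2[OF bump_has_derivative this]
      have "((\<lambda>r. r powr b * bump (ln r / N)) has_real_derivative
          (b * r powr (b - 1)) * bump (ln r / N) + (bump_deriv (ln r / N) * (1 / (r * N))) * r powr b) (at r)"
        using r by (intro DERIV_mult) (auto intro!: derivative_eq_intros)
      moreover have "(norm has_derivative (\<lambda>h. h \<bullet> sgn x)) (at x)"
        using GDERIV_norm[OF that] by (simp add: gderiv_def)
      ultimately have "(g has_derivative (\<lambda>h. ((b * r powr (b - 1)) * bump (ln r / N)
          + (bump_deriv (ln r / N) * (1 / (r * N))) * r powr b) * (h \<bullet> sgn x))) (at x)"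
        unfolding g_def[abs_def] r_def has_field_derivative_def by (rule has_derivative_compose[rotated])
      then have "partial j g x = ((b * r powr (b - 1)) * bump (ln r / N)
          + (bump_deriv (ln r / N) * (1 / (r * N))) * r powr b) * (axis j 1 \<bullet> sgn x)"
        by (rule partial_eqI)
      moreover have "axis j 1 \<bullet> sgn x = x $ j / r"
        by (simp add: inner_axis' sgn_div_norm r_def divide_inverse mult.commute)
      ultimately show ?thesis
        using r by (simp add: G_def r_def[symmetric] powr_diff power2_eq_square field_simps)
    qed
    have "integral\<^sup>L lborel (\<lambda>x. (norm (u x))\<^sup>2 * ((p - 1) * (\<alpha>\<^sup>2 * (g x)\<^sup>2 / (norm x)\<^sup>2 - 2 * \<alpha> * g x * G x)
      - (G x)\<^sup>2 * (norm x)\<^sup>2)) \<le> 0"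
      by (rule radial_test_inequality[OF p smooth homogeneous equation stab g_smooth, where R = "exp N"])
        (simp_all add: G_cont grad, simp_all add: g_def G_def bump_outside[OF outside])
    also have "(\<lambda>x. (norm (u x))\<^sup>2 * ((p - 1) * (\<alpha>\<^sup>2 * (g x)\<^sup>2 / (norm x)\<^sup>2 - 2 * \<alpha> * g x * G x)
        - (G x)\<^sup>2 * (norm x)\<^sup>2))
      = (\<lambda>x. w x * (c * (?\<eta> x)\<^sup>2 - (2 * \<alpha> * (p - 1) + 2 * b) * ?\<eta> x * ?\<eta>' x - (?\<eta>' x)\<^sup>2))"
    proof
      fix x :: "real^'n"
      show "(norm (u x))\<^sup>2 * ((p - 1) * (\<alpha>\<^sup>2 * (g x)\<^sup>2 / (norm x)\<^sup>2 - 2 * \<alpha> * g x * G x)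
          - (G x)\<^sup>2 * (norm x)\<^sup>2)
        = w x * (c * (?\<eta> x)\<^sup>2 - (2 * \<alpha> * (p - 1) + 2 * b) * ?\<eta> x * ?\<eta>' x - (?\<eta>' x)\<^sup>2)"
      proof (cases "x = 0")
        case False
        define r where "r = norm x"
        have r: "r > 0" using False by (simp add: r_def)
        define q where "q = r powr (2 * \<alpha> - ?n)"
        \<comment> \<open>Both sides equal \<open>2b - 2\<close>, the power of the norm common to
          all three terms below.\<close>
        have "2 * \<alpha> - ?n = (b - 2) + (b - 2) + 2" by (simp add: b_def)
        then have q: "q = (r powr (b - 2))\<^sup>2 * r\<^sup>2"
          using r unfolding q_def by (simp only: powr_add powr_numeral power2_eq_square)
        have rb: "r powr b = r powr (b - 2) * r\<^sup>2"
          using r by (simp add: powr_diff)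
        define e e' where "e = ?\<eta> x" and "e' = ?\<eta>' x"
        have g: "g x = r powr (b - 2) * r\<^sup>2 * e"
          unfolding g_def e_def rb[symmetric] by (simp add: r_def)
        have G: "G x = r powr (b - 2) * (b * e + e')"
          by (simp add: G_def r_def e_def e'_def)
        have 1: "(g x)\<^sup>2 / (norm x)\<^sup>2 = q * e\<^sup>2"
          using r unfolding g q r_def[symmetric] by (simp add: power2_eq_square)
        have 2: "g x * G x = q * (e * (b * e + e'))"
          unfolding g G q by (simp add: power2_eq_square)
        have 3: "(G x)\<^sup>2 * (norm x)\<^sup>2 = q * (b * e + e')\<^sup>2"
          unfolding G q r_def[symmetric] by (simp add: power2_eq_square)
        have "(norm (u x))\<^sup>2 * ((p - 1) * (\<alpha>\<^sup>2 * ((g x)\<^sup>2 / (norm x)\<^sup>2) - 2 * \<alpha> * (g x * G x)) - (G x)\<^sup>2 * (norm x)\<^sup>2)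
          = q * (norm (u x))\<^sup>2 * (((p - 1) * (\<alpha>\<^sup>2 - 2 * \<alpha> * b) - b\<^sup>2) * e\<^sup>2 - (2 * \<alpha> * (p - 1) + 2 * b) * e * e' - e'\<^sup>2)"
          unfolding 1 2 3 by (simp add: power2_eq_square algebra_simps)
        \<comment> \<open>The choice of \<open>b\<close> turns \<open>\<alpha> - 2b\<close> into
          \<open>n - 2 - \<alpha>\<close>.\<close>
        also have "(p - 1) * (\<alpha>\<^sup>2 - 2 * \<alpha> * b) - b\<^sup>2 = c"
        proof -
          have "\<alpha>\<^sup>2 - 2 * \<alpha> * b = \<alpha> * (?n - 2 - \<alpha>)" by (simp add: b_def power2_eq_square field_simps)
          then show ?thesis by (simp add: c_def mult.assoc)
        qed
        finally show ?thesis
          by (simp add: w_def q_def r_def e_def e'_def mult.assoc)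
      qed (simp add: w_def g_def G_def)
    qed
    finally show "integral\<^sup>L lborel (\<lambda>x. w x * (c * (?\<eta> x)\<^sup>2
      - (2 * \<alpha> * (p - 1) + 2 * b) * ?\<eta> x * ?\<eta>' x - (?\<eta>' x)\<^sup>2)) \<le> 0" .
  qed
  then show ?thesis using \<open>x \<noteq> 0\<close> by (simp add: w_def)
qed

text \<open>With \<open>\<alpha> = 2 / (p - 1)\<close> the product \<open>(p - 1) * \<alpha>\<close>
  is 2, and completing the square turns the claim into
  \<open>(\<alpha> - (N - 4) / 2)^2 < N - 1\<close>. So \<open>\<alpha>\<close> must lie strictly
  between the roots \<open>(N - 4) / 2 - s\<close> and \<open>(N - 4) / 2 + s\<close> with
  \<open>s = sqrt (N - 1)\<close>. The lower bound on \<open>p\<close> gives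
  \<open>\<alpha> < (N - 2) / 2\<close>, below the upper root as \<open>s > 1\<close>; the upper
  bound on \<open>p\<close> takes care of the lower root.\<close>

lemma Joseph_Lundgren_condition:
  fixes n :: nat and p :: real
  assumes n: "n \<ge> 3" and low: "(real n + 2) / (real n - 2) < p" and high: "ereal p < p_c n"
  shows "p > 1"
    and "(p - 1) * (2 / (p - 1)) * (real n - 2 - 2 / (p - 1)) > (2 / (p - 1) - (real n - 2) / 2)\<^sup>2"
proof -
  define N \<alpha> s where "N = real n" and "\<alpha> = 2 / (p - 1)" and "s = sqrt (N - 1)"
  have N: "N \<ge> 3" using n by (simp add: N_def)
  have "4 / (N - 2) = (N + 2) / (N - 2) - 1" using N by (simp add: field_simps)
  then have p4: "p - 1 > 4 / (N - 2)" using low by (simp add: N_def)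
  moreover have "4 / (N - 2) > 0" using N by simp
  ultimately show "p > 1" by linarith
  have s2: "s\<^sup>2 = N - 1" using N by (simp add: s_def)
  have s1: "s > 1" using N by (simp add: s_def)
  have upper: "\<alpha> < (N - 4) / 2 + s"
  proof -
    have "\<alpha> < (N - 2) / 2" using p4 N \<open>p > 1\<close> by (simp add: \<alpha>_def field_simps)
    then show ?thesis using s1 by (simp add: field_simps)
  qed
  have lower: "\<alpha> > (N - 4) / 2 - s"
  proof (cases "n \<le> 10")
    case True
    have "(N - 4) / 2 \<le> s"
    proof (cases "N \<ge> 4")
      case True
      have "(N - 2) * (N - 10) \<le> 0" using N \<open>n \<le> 10\<close> by (intro mult_nonneg_nonpos) (auto simp: N_def)
      \<comment> \<open>The sign of \<open>(N - 2) * (N - 10)\<close> decides whether the lower root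
        is positive; this is where dimension 10 enters.\<close>
      moreover have "((N - 4) / 2)\<^sup>2 = (N - 2) * (N - 10) / 4 + s\<^sup>2"
        unfolding s2 by (simp add: power2_eq_square field_simps)
      ultimately have "((N - 4) / 2)\<^sup>2 \<le> s\<^sup>2" by linarith
      then show ?thesis by (rule power2_le_imp_le) (use s1 in linarith)
    next
      case False
      then have "(N - 4) / 2 \<le> 0" by simp
      then show ?thesis using s1 by linarith
    qed
    moreover have "\<alpha> > 0" using \<open>p > 1\<close> by (simp add: \<alpha>_def)
    ultimately show ?thesis by linarith
  next
    case False
    then have N11: "N \<ge> 11" by (simp add: N_def)
    \<comment> \<open>A difference of squares: the factors on the right are twice the two
      roots.\<close>
    have fact: "(N - 2) * (N - 10) = (N - 4 - 2 * s) * (N - 4 + 2 * s)"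
      using s2 by (simp add: power2_eq_square algebra_simps)
    have "(N - 2) * (N - 10) > 0" using N11 by simp
    moreover have pos: "N - 4 + 2 * s > 0" using N11 s1 by simp
    ultimately have pos': "N - 4 - 2 * s > 0" unfolding fact by (simp add: zero_less_mult_iff)
    have "p < ((N - 2)\<^sup>2 - 4 * N + 8 * s) / ((N - 2) * (N - 10))"
      using high False by (simp add: p_c_def N_def s_def)
    also have "\<dots> = 1 + 4 * (N - 4 + 2 * s) / ((N - 2) * (N - 10))"
    proof -
      have "(N - 2)\<^sup>2 - 4 * N + 8 * s = (N - 2) * (N - 10) + 4 * (N - 4 + 2 * s)"
        by (simp add: power2_eq_square algebra_simps)
      moreover have "(N - 2) * (N - 10) \<noteq> 0" using N11 by simp
      ultimately show ?thesis by (metis add_divide_distrib divide_self)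
    qed
    \<comment> \<open>Thus the critical exponent is the value of \<open>p\<close> at which
      \<open>\<alpha>\<close> equals the lower root.\<close>
    also have "\<dots> = 1 + 4 / (N - 4 - 2 * s)"
      unfolding fact using pos by (metis less_irrefl mult_divide_mult_cancel_right)
    finally have "p - 1 < 4 / (N - 4 - 2 * s)" by simp
    then show ?thesis using \<open>p > 1\<close> pos' by (simp add: \<alpha>_def field_simps)
  qed
  have "(\<alpha> - (N - 4) / 2)\<^sup>2 < s\<^sup>2"
    using upper lower s1 by (intro power2_strict_mono) auto
  then have "(\<alpha> - (N - 2) / 2)\<^sup>2 < 2 * (N - 2 - \<alpha>)"
    unfolding s2 by (simp add: power2_eq_square field_simps)
  moreover have "(p - 1) * \<alpha> = 2"
    unfolding \<alpha>_def times_divide_eq_right by (rule nonzero_mult_div_cancel_left) (use \<open>p > 1\<close> in simp)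
  ultimately have "(p - 1) * \<alpha> * (N - 2 - \<alpha>) > (\<alpha> - (N - 2) / 2)\<^sup>2" by simp
  then show "(p - 1) * (2 / (p - 1)) * (real n - 2 - 2 / (p - 1)) > (2 / (p - 1) - (real n - 2) / 2)\<^sup>2"
    unfolding \<alpha>_def N_def .
qed

section \<open>Conclusion for the profiles on the sphere\<close>

theorem theorem2p4:
  fixes u :: "real^'n \<Rightarrow> real^'m"
    and \<psi> :: "'m \<Rightarrow> real^'n \<Rightarrow> real"
    and p :: real
  assumes n3: "CARD('n) \<ge> 3"
    and hom: "\<And>i x. x \<noteq> 0 \<Longrightarrow> u x $ i = norm x powr (- 2 / (p - 1)) * \<psi> i (x /\<^sub>R norm x)"
    and psi_smooth: "\<And>i. \<exists>U. sphere 0 1 \<subseteq> U \<and> C_inf_on U (\<psi> i)"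
    and eq: "\<And>i x. x \<noteq> 0 \<Longrightarrow> - laplacian (\<lambda>y. u y $ i) x = norm (u x) powr (p - 1) * (u x $ i)"
    and stab: "stable p u"
    and p_low: "(real CARD('n) + 2) / (real CARD('n) - 2) < p"
    and p_high: "ereal p < p_c CARD('n)"
  shows "\<forall>i. \<forall>\<theta>\<in>sphere 0 1. \<psi> i \<theta> = 0"
proof -
  note JL = Joseph_Lundgren_condition[OF n3 p_low p_high]
  \<comment> \<open>Each \<open>\<psi> i\<close> is smooth on an open neighbourhood of the sphere,
    so it can be composed with the retraction \<open>x / |x|\<close>, smooth off the origin.\<close>
  have smooth: "C_k_on k (- {0}) (\<lambda>x. u x $ i)" for i k
  proof -
    obtain U where U: "sphere 0 1 \<subseteq> U" "C_k_on k U (\<psi> i)"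
      using psi_smooth[of i] unfolding C_inf_on_def by blast
    have "C_k_on k (- {0}) (\<lambda>x::real^'n. norm x powr (- 1) * x $ l)" for l
      by (intro C_k_on_mult C_k_on_norm_powr C_k_on_nth) auto
    moreover have "(\<lambda>x::real^'n. norm x powr (- 1) * x $ l) = (\<lambda>x. (x /\<^sub>R norm x) $ l)" for l
      by (simp add: fun_eq_iff divide_inverse mult.commute)
    ultimately have "C_k_on k (- {0}) (\<lambda>x::real^'n. (x /\<^sub>R norm x) $ l)" for l
      by (simp only:)
    then have "C_k_on k (- {0}) (\<lambda>x. \<psi> i (x /\<^sub>R norm x))"
      using U by (intro C_k_on_compose[where U = U and f = "\<psi> i" and \<Phi> = "\<lambda>x. x /\<^sub>R norm x"]) auto
    then have "C_k_on k (- {0}) (\<lambda>x. norm x powr (- 2 / (p - 1)) * \<psi> i (x /\<^sub>R norm x))"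
      by (intro C_k_on_mult C_k_on_norm_powr) auto
    moreover have "open (- {0::real^'n})" by auto
    ultimately show ?thesis
      using C_k_on_cong[of "- {0}" "\<lambda>x. u x $ i" "\<lambda>x. norm x powr (- 2 / (p - 1)) * \<psi> i (x /\<^sub>R norm x)" k] hom
      by blast
  qed
  have homogeneous: "u (c *\<^sub>R x) = c powr (- (2 / (p - 1))) *\<^sub>R u x" if "c > 0" "x \<noteq> 0" for c x
  proof -
    have "(c *\<^sub>R x) /\<^sub>R norm (c *\<^sub>R x) = x /\<^sub>R norm x" using that by simp
    then have "u (c *\<^sub>R x) $ i = c powr (- (2 / (p - 1))) * u x $ i" for i
      using that by (simp add: hom powr_mult del: scaleR_scaleR)
    then show ?thesis by (simp add: vec_eq_iff)
  qed
  have "u x = 0" if "x \<noteq> 0" for x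
    using stable_homogeneous_solution_eq_0[OF JL(1) smooth homogeneous eq stab JL(2) that] .
  \<comment> \<open>On the unit sphere the radial factor is 1, so \<open>u\<close> and the profiles
    have the same values there.\<close>
  then have "\<psi> i \<theta> = 0" if "\<theta> \<in> sphere 0 1" for i \<theta>
    using hom[of \<theta> i] that by (cases "\<theta> = 0") auto
  then show ?thesis by blast
qed

end
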